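(* For all $n \in \mathbb{N}$, $$NT2(1,5,5n+1) - NT2(4,5,5n+1) + 2\,NT2(2,5,5n+1)-2\,NT2(3,5,5n+1)\equiv 0\pmod{5}.$$
   Context: $\mathbb{N}=\{0,1,2,\dots\}$. A partition of $n$ is a non-increasing sequence of positive integers (its parts) whose sum is $n$. A partition without repeated odd parts is a partition in which each odd number occurs at most once as a part (even parts may repeat). For such a partition $\lambda$, let $\ell(\lambda)$ be its largest part and $n(\lambda)$ its number of parts; its $M_2$-rank is $$\text{$M_2$-rank}(\lambda)=\left\lceil\frac{\ell(\lambda)}{2}\right\rceil - n(\lambda).$$ $NT2(b,k,n)$ denotes the total number of parts in the partitions of $n$ without repeated odd parts with $M_2$-rank congruent to $b$ modulo $k$, i.e. the sum of $n(\lambda)$ over all such partitions $\lambda$ of $n$. *)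

theory Defs
  imports Complex_Main "HOL-Number_Theory.Cong"
begin

definition is_partition :: "nat list \<Rightarrow> nat \<Rightarrow> bool" where
  "is_partition xs n \<longleftrightarrow>
     sorted_wrt (\<ge>) xs \<and> (\<forall>x \<in> set xs. 0 < x) \<and> sum_list xs = n"

definition no_repeated_odd :: "nat list \<Rightarrow> bool" where
  "no_repeated_odd xs \<longleftrightarrow> (\<forall>j. odd j \<longrightarrow> count_list xs j \<le> 1)"

text \<open>The inserted 0 only matters for the empty partition, whose largest part is set to 0.\<close>

definition largest_part :: "nat list \<Rightarrow> nat" where
  "largest_part xs = Max (insert 0 (set xs))"

definition M2_rank :: "nat list \<Rightarrow> int" where
  "M2_rank xs = \<lceil>real (largest_part xs) / 2\<rceil> - int (length xs)"

definition NT2 :: "int \<Rightarrow> int \<Rightarrow> nat \<Rightarrow> nat" where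
  "NT2 b k n =
     (\<Sum>xs | is_partition xs n \<and> no_repeated_odd xs \<and> [M2_rank xs = b] (mod k). length xs)"

text \<open>The index set of the sum in \<open>NT2\<close> is finite, so the sum is a genuine one.\<close>

lemma finite_partitions: "finite {xs. is_partition xs n}"
proof (rule finite_subset)
  have "length xs \<le> sum_list xs" if "\<forall>x \<in> set xs. 0 < x" for xs :: "nat list"
    using that by (induction xs) auto
  then show "{xs. is_partition xs n} \<subseteq> {xs. set xs \<subseteq> {..n} \<and> length xs \<le> n}"
    by (auto simp: is_partition_def member_le_sum_list)
qed (simp add: finite_lists_length_le)

lemma finite_NT2_index:
  "finite {xs. is_partition xs n \<and> no_repeated_odd xs \<and> [M2_rank xs = b] (mod k)}"
  by (rule finite_subset[OF _ finite_partitions[of n]]) auto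

end

theory Submission
  imports Defs "HOL-Computational_Algebra.Formal_Power_Series" "HOL-Library.Numeral_Type"
begin

text \<open>
  Modulo 5 the weights $1, 2, -2, -1$ of the residue classes $1, 2, 3, 4$ are the classes themselves, so the
  claim is that $S(N) = \sum n(\lambda) (c(\lambda) - n(\lambda))$ vanishes modulo 5 for $N = 5n + 1$, where
  $c(\lambda)$ is half the largest part, rounded up. The pair of statistics $(c, n)$ is symmetrically
  distributed, which gives $-S(N) = \sum_{m \ge 1} (2m - 1) \# \{\lambda : c - n \ge m\}$. A Dyson type
  recursion in $m$ shows that the generating function of these cardinalities at $-q$ is $- P H_m$, where
  $H_m = \sum_{n \ge 1} q^{n (2n + 2m - 1)}$ and $P = 1 / \psi$ with $\psi = \sum_i q^{i(i+1)/2}$. Hence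
  $\sum_N S(N) (-q)^N = P X_1$ for an explicit Lambert series $X_1$.

  With $D = q\,d/dq$, it suffices to find $V$ with $P X_1 = D(PV) - PV$ modulo 5, because the
  coefficient of $q^N$ on the right has the factor $N - 1$. Multiplying by $\psi$ turns the contribution of
  $X_1$ into a sum over the solutions of $y^2 + t^2 - x^2 = 8N + 1$ with $0 < x < t$. Its summand
  is antisymmetric in $y$ and $t$, so the part with $y > x$ cancels. The part with $y < x$ is, by the
  symmetry $(y, t, x) \mapsto (-t, -y, -x)$, half of the sum over $y < x < t$ without a sign condition, and
  there the coordinate $y + t - x$ decouples. What remains is expressed by Eisenstein series, whose
  $D$-derivatives modulo 5 are polynomials in the series of weight two.
\<close>

subsection \<open>Lambert series and Liouville's identity\<close>

text \<open>The obstacle is the cone condition 2n < d in X_1: it makes X_1 an indefinite sum instead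
  of an Eisenstein series, and psi X_1 alone has no useful symmetry. Therefore V begins with
  -\<open>W0\<close>, the sum over the same cone with 2x - x^3 in place of the weight x = d - 2n. In
  psi (D W0 - W0) - (D psi) W0 + psi X_1 the weights then combine, by Fermat's x^5 = x, to 2 (t^2 -
  y^2)(2x - x^3), and only this combination is antisymmetric.

  The points with y = x belong to neither symmetry; they contribute multiples of D psi - D^2 psi.
  The decoupled part produces derivatives of psi times the divisor sums sigma_1 and sigma_3 at q^4.
  The sigma_3 terms already have the form D Y - u Y - Y with u = D psi / psi, which is D(PY) - PY
  divided by P. For the rest such a Y is found among the quadratic polynomials in three weight two
  series, because u is itself one of their combinations and E_4 = 1 modulo 5 closes them under D and
  relates them at level four.\<close>

definition qD :: "'a::comm_ring_1 fps \<Rightarrow> 'a fps" where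
  "qD f = fps_X * fps_deriv f"

lemma qD_nth: "fps_nth (qD f) n = of_nat n * fps_nth f n"
  by (cases n) (simp_all add: qD_def)

lemma qD_add: "qD (f + g) = qD f + qD g"
  and qD_diff: "qD (f - g) = qD f - qD g"
  and qD_minus: "qD (- f) = - qD f"
  by (simp_all add: qD_def algebra_simps)

lemma qD_mult: "qD (f * g) = qD f * g + f * qD g"
  by (simp add: qD_def algebra_simps)

lemma qD_1: "qD 1 = 0"
  by (simp add: qD_def)

lemma qD_numeral_mult: "qD (numeral k * f) = numeral k * qD f"
  by (simp add: qD_def algebra_simps flip: numeral_fps_const)

section \<open>Lambert series and their products\<close>

definition facs :: "nat \<Rightarrow> (nat \<times> nat) set" where
  "facs n = {(e, k). 0 < e \<and> 0 < k \<and> e * k = n}"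

text \<open>Since \<open>facs 0\<close> is empty the constant term is 0, so Eisenstein series enter
  below without their constant terms.\<close>

definition Lam :: "(nat \<Rightarrow> nat \<Rightarrow> 'a::comm_ring_1) \<Rightarrow> 'a fps" where
  "Lam f = Abs_fps (\<lambda>n. \<Sum>(e, k)\<in>facs n. f e k)"

definition quads :: "nat \<Rightarrow> (nat \<times> nat \<times> nat \<times> nat) set" where
  "quads n = {(a, x, b, y). 0 < a \<and> 0 < x \<and> 0 < b \<and> 0 < y \<and> a * x + b * y = n}"

lemma finite_facs: "finite (facs n)"
proof (rule finite_subset)
  show "facs n \<subseteq> {..n} \<times> {..n}" by (auto simp: facs_def)
qed auto

lemma finite_quads: "finite (quads n)"
proof (rule finite_subset)
  have "a \<le> a * x + b * y" "b \<le> a * x + b * y" "x \<le> a * x + b * y" "y \<le> a * x + b * y"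
    if "0 < a" "0 < x" "0 < b" "0 < y" for a b x y :: nat
    using that by (simp_all add: trans_le_add1 trans_le_add2)
  then show "quads n \<subseteq> {..n} \<times> {..n} \<times> {..n} \<times> {..n}"
    unfolding quads_def by auto
qed auto

lemma Lam_nth: "fps_nth (Lam f) n = (\<Sum>(e, k)\<in>facs n. f e k)"
  by (simp add: Lam_def)

lemma Lam_mult_nth:
  "fps_nth (Lam f * Lam g) n = (\<Sum>(a, x, b, y)\<in>quads n. f a x * g b y)"
proof -
  have "fps_nth (Lam f * Lam g) n =
      (\<Sum>i\<in>{0..n}. \<Sum>p\<in>facs i. \<Sum>q\<in>facs (n - i). f (fst p) (snd p) * g (fst q) (snd q))"
    by (simp add: fps_mult_nth Lam_nth sum_product case_prod_unfold)
  also have "\<dots> = (\<Sum>(i, p, q)\<in>(SIGMA i:{0..n}. SIGMA p:facs i. facs (n - i)).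
                    f (fst p) (snd p) * g (fst q) (snd q))"
    by (simp add: sum.Sigma finite_facs case_prod_unfold)
  also have "\<dots> = (\<Sum>(a, x, b, y)\<in>quads n. f a x * g b y)"
    by (rule sum.reindex_bij_witness[where
          i = "\<lambda>(a, x, b, y). (a * x, (a, x), (b, y))" and
          j = "\<lambda>(i, p, q). (fst p, snd p, fst q, snd q)"])
       (auto simp: facs_def quads_def)
  finally show ?thesis .
qed

lemma quads_swap:
  "(\<Sum>(a, x, b, y)\<in>{(a, x, b, y) \<in> quads n. P a x b y}. h a x b y) =
   (\<Sum>(a, x, b, y)\<in>{(a, x, b, y) \<in> quads n. P b y a x}. h b y a x)"
  by (rule sum.reindex_bij_witness[where
          i = "\<lambda>(a, x, b, y). (b, y, a, x)" and j = "\<lambda>(a, x, b, y). (b, y, a, x)"])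
     (auto simp: quads_def)

lemma quads_shear:
  "(\<Sum>(a, x, b, y)\<in>{(a, x, b, y) \<in> quads n. x < y}. h a x b y) =
   (\<Sum>(a, x, b, y)\<in>{(a, x, b, y) \<in> quads n. b < a}. h (a - b) x b (x + y))"
  by (rule sum.reindex_bij_witness[where
          i = "\<lambda>(a, x, b, y). (a - b, x, b, x + y)" and j = "\<lambda>(a, x, b, y). (a + b, x, b, y - x)"])
     (auto simp: quads_def algebra_simps dest!: less_imp_Suc_add)

lemma sum_trichotomy:
  fixes u v :: "'b \<Rightarrow> 'c::linorder"
  assumes "finite A"
  shows "sum h A = sum h {q \<in> A. u q < v q} + sum h {q \<in> A. v q < u q} + sum h {q \<in> A. u q = v q}"
proof -
  have "A = {q \<in> A. u q < v q} \<union> {q \<in> A. v q < u q} \<union> {q \<in> A. u q = v q}" by auto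
  then have "sum h A = sum h ({q \<in> A. u q < v q} \<union> {q \<in> A. v q < u q} \<union> {q \<in> A. u q = v q})" by simp
  also have "\<dots> = sum h {q \<in> A. u q < v q} + sum h {q \<in> A. v q < u q} + sum h {q \<in> A. u q = v q}"
    using assms by (subst sum.union_disjoint; auto)+
  finally show ?thesis .
qed

lemma quads_split_cols:
  "(\<Sum>(a, x, b, y)\<in>quads n. h a x b y) =
     (\<Sum>(a, x, b, y)\<in>{(a, x, b, y) \<in> quads n. b < a}. h a x b y) +
     (\<Sum>(a, x, b, y)\<in>{(a, x, b, y) \<in> quads n. a < b}. h a x b y) +
     (\<Sum>(a, x, b, y)\<in>{(a, x, b, y) \<in> quads n. a = b}. h a x b y)"
  using sum_trichotomy[OF finite_quads, of "\<lambda>(a, x, b, y). h a x b y" n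
          "\<lambda>(a, x, b, y). b" "\<lambda>(a, x, b, y). a"]
  by (simp add: case_prod_unfold eq_commute)

lemma quads_split_rows:
  "(\<Sum>(a, x, b, y)\<in>quads n. h a x b y) =
     (\<Sum>(a, x, b, y)\<in>{(a, x, b, y) \<in> quads n. x < y}. h a x b y) +
     (\<Sum>(a, x, b, y)\<in>{(a, x, b, y) \<in> quads n. y < x}. h a x b y) +
     (\<Sum>(a, x, b, y)\<in>{(a, x, b, y) \<in> quads n. x = y}. h a x b y)"
  using sum_trichotomy[OF finite_quads, of "\<lambda>(a, x, b, y). h a x b y" n
          "\<lambda>(a, x, b, y). x" "\<lambda>(a, x, b, y). y"]
  by (simp add: case_prod_unfold)

text \<open>On x = y the equation reads (a + b) x = n: a factorization of n with a splitting of its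
  first factor. The case a = b splits the second factor k instead, in k - 1 ways.\<close>

lemma quads_equal_rows:
  "(\<Sum>(a, x, b, y)\<in>{(a, x, b, y) \<in> quads n. x = y}. h a b) =
   (\<Sum>(e, k)\<in>facs n. \<Sum>l\<in>{1..<e}. h l (e - l))"
proof -
  have "(\<Sum>(e, k)\<in>facs n. \<Sum>l\<in>{1..<e}. h l (e - l)) =
        (\<Sum>(p, l)\<in>(SIGMA p:facs n. {1..<fst p}). h l (fst p - l))"
    by (simp add: sum.Sigma finite_facs case_prod_unfold)
  also have "\<dots> = (\<Sum>(a, x, b, y)\<in>{(a, x, b, y) \<in> quads n. x = y}. h a b)"
    by (rule sum.reindex_bij_witness[where
          i = "\<lambda>(a, x, b, y). ((a + b, x), a)" and j = "\<lambda>(p, l). (l, snd p, fst p - l, snd p)"])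
       (auto simp: quads_def facs_def algebra_simps dest!: less_imp_Suc_add)
  finally show ?thesis by simp
qed

lemma quads_equal_cols:
  "(\<Sum>(a, x, b, y)\<in>{(a, x, b, y) \<in> quads n. a = b}. h a) =
   (\<Sum>(e, k)\<in>facs n. (of_nat k - 1) * (h e :: 'a::comm_ring_1))"
proof -
  have "(\<Sum>(e, k)\<in>facs n. (of_nat k - 1) * h e) = (\<Sum>(e, k)\<in>facs n. \<Sum>l\<in>{1..<k}. h e)"
    by (intro sum.cong) (auto simp: facs_def of_nat_diff)
  also have "\<dots> = (\<Sum>(p, l)\<in>(SIGMA p:facs n. {1..<snd p}). h (fst p))"
    by (simp add: sum.Sigma finite_facs case_prod_unfold del: sum_constant)
  also have "\<dots> = (\<Sum>(a, x, b, y)\<in>{(a, x, b, y) \<in> quads n. a = b}. h a)"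
    by (rule sum.reindex_bij_witness[where
          i = "\<lambda>(a, x, b, y). ((a, x + y), x)" and j = "\<lambda>(p, l). (fst p, l, fst p, snd p - l)"])
       (auto simp: quads_def facs_def algebra_simps dest!: less_imp_Suc_add)
  finally show ?thesis by simp
qed

text \<open>
  Every sum over \<open>quads n\<close> is split by the sign of \<open>a - b\<close> or of \<open>x - y\<close>; the shear
  $(a, x, b, y) \mapsto (a + b, x, b, y - x)$ exchanges the two kinds of pieces.
\<close>

lemma liouville:
  fixes F :: "nat \<Rightarrow> 'a::comm_ring_1"
  assumes F0: "F 0 = 0"
  shows "(\<Sum>(a, x, b, y)\<in>quads n. F (a + b) - F ((a - b) + (b - a))) =
         (\<Sum>(e, k)\<in>facs n. (of_nat e - 1) * F e + 2 * (\<Sum>l\<in>{1..<e}. F l)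
                              - 2 * ((of_nat k - 1) * F e))"
proof -
  let ?Q = "\<lambda>P. {(a, x, b, y) \<in> quads n. P a x b y}"
  let ?S = "\<lambda>P h. \<Sum>(a, x, b, y)\<in>?Q P. h a x b y"
  have plus: "(\<Sum>(a, x, b, y)\<in>quads n. F (a + b)) =
      2 * ?S (\<lambda>a x b y. b < a) (\<lambda>a x b y. F a) + ?S (\<lambda>a x b y. x = y) (\<lambda>a x b y. F (a + b))"
  proof -
    have "?S (\<lambda>a x b y. y < x) (\<lambda>a x b y. F (a + b)) = ?S (\<lambda>a x b y. x < y) (\<lambda>a x b y. F (a + b))"
      by (subst quads_swap) (simp add: add.commute)
    moreover have "?S (\<lambda>a x b y. x < y) (\<lambda>a x b y. F (a + b)) = ?S (\<lambda>a x b y. b < a) (\<lambda>a x b y. F a)"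
      by (subst quads_shear) (rule sum.cong, auto)
    ultimately show ?thesis
      by (subst quads_split_rows) simp
  qed
  \<comment> \<open>With truncated subtraction, \<open>(a - b) + (b - a)\<close> is the distance of
    a and b. Swapping identifies the pieces a < b and b < a, and a = b contributes F 0 = 0.\<close>
  have minus: "(\<Sum>(a, x, b, y)\<in>quads n. F ((a - b) + (b - a))) =
      2 * ?S (\<lambda>a x b y. x < y) (\<lambda>a x b y. F a)"
  proof -
    have "?S (\<lambda>a x b y. a < b) (\<lambda>a x b y. F ((a - b) + (b - a))) =
          ?S (\<lambda>a x b y. b < a) (\<lambda>a x b y. F ((a - b) + (b - a)))"
      by (subst quads_swap) (simp add: add.commute)
    moreover have "?S (\<lambda>a x b y. x < y) (\<lambda>a x b y. F a) =
          ?S (\<lambda>a x b y. b < a) (\<lambda>a x b y. F ((a - b) + (b - a)))"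
      by (subst quads_shear) (rule sum.cong, auto)
    moreover have "?S (\<lambda>a x b y. a = b) (\<lambda>a x b y. F ((a - b) + (b - a))) = 0"
      by (rule sum.neutral) (auto simp: F0)
    ultimately show ?thesis
      by (subst quads_split_cols) simp
  qed
  have "?S (\<lambda>a x b y. y < x) (\<lambda>a x b y. F a) = ?S (\<lambda>a x b y. a < b) (\<lambda>a x b y. F a)"
  proof -
    have "?S (\<lambda>a x b y. y < x) (\<lambda>a x b y. F a) = ?S (\<lambda>a x b y. x < y) (\<lambda>a x b y. F b)"
      by (subst quads_swap) simp
    also have "\<dots> = ?S (\<lambda>a x b y. b < a) (\<lambda>a x b y. F b)"
      by (subst quads_shear) simp
    also have "\<dots> = ?S (\<lambda>a x b y. a < b) (\<lambda>a x b y. F a)"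
      by (subst quads_swap) simp
    finally show ?thesis .
  qed
  \<comment> \<open>The same sum of F a is split by columns and by rows. Two off-diagonal pieces
    agree, so the other two differ by the diagonals only.\<close>
  moreover have "?S (\<lambda>a x b y. b < a) (\<lambda>a x b y. F a) + ?S (\<lambda>a x b y. a < b) (\<lambda>a x b y. F a)
      + ?S (\<lambda>a x b y. a = b) (\<lambda>a x b y. F a) =
      ?S (\<lambda>a x b y. x < y) (\<lambda>a x b y. F a) + ?S (\<lambda>a x b y. y < x) (\<lambda>a x b y. F a)
      + ?S (\<lambda>a x b y. x = y) (\<lambda>a x b y. F a)"
    by (subst quads_split_cols[symmetric], subst quads_split_rows[symmetric]) simp
  ultimately have diff: "?S (\<lambda>a x b y. b < a) (\<lambda>a x b y. F a) - ?S (\<lambda>a x b y. x < y) (\<lambda>a x b y. F a) =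
      ?S (\<lambda>a x b y. x = y) (\<lambda>a x b y. F a) - ?S (\<lambda>a x b y. a = b) (\<lambda>a x b y. F a)"
    by (simp add: algebra_simps)
  have "(\<Sum>(a, x, b, y)\<in>quads n. F (a + b) - F ((a - b) + (b - a))) =
      (\<Sum>(a, x, b, y)\<in>quads n. F (a + b)) - (\<Sum>(a, x, b, y)\<in>quads n. F ((a - b) + (b - a)))"
    by (simp add: sum_subtractf case_prod_unfold)
  also have "\<dots> = 2 * (?S (\<lambda>a x b y. x = y) (\<lambda>a x b y. F a) - ?S (\<lambda>a x b y. a = b) (\<lambda>a x b y. F a))
       + ?S (\<lambda>a x b y. x = y) (\<lambda>a x b y. F (a + b))"
    unfolding plus minus diff[symmetric] by (simp add: algebra_simps)
  also have "\<dots> = (\<Sum>(e, k)\<in>facs n. 2 * ((\<Sum>l\<in>{1..<e}. F l) - (of_nat k - 1) * F e) + (\<Sum>l\<in>{1..<e}. F e))"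
    unfolding quads_equal_rows quads_equal_cols
    by (simp add: case_prod_unfold sum.distrib sum_subtractf sum_distrib_left right_diff_distrib del: sum_constant)
  also have "\<dots> = (\<Sum>(e, k)\<in>facs n. (of_nat e - 1) * F e + 2 * (\<Sum>l\<in>{1..<e}. F l)
                              - 2 * ((of_nat k - 1) * F e))"
    by (intro sum.cong) (auto simp: facs_def of_nat_diff algebra_simps)
  finally show ?thesis .
qed

subsection \<open>Eisenstein series modulo 5\<close>

lemma five: "(5::5) = 0" by simp

lemma five_fps: "(5::5 fps) = 0"
proof -
  have "fps_const (5::5) = (5::5 fps)" by (rule numeral_fps_const[symmetric])
  moreover have "fps_const (5::5) = 0" by (metis fps_const_0_eq_0 five)
  ultimately show ?thesis by simp
qed

text \<open>Stated for every ring with 5 = 0, so that it serves residues and power series alike. The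
  explicit cofactor c turns a congruence into a polynomial identity that normalization can
  check.\<close>

lemma eq_mod5:
  fixes a b c :: "'a::comm_ring_1"
  assumes "(5::'a) = 0" "a - b = 5 * c"
  shows "a = b"
  using assms by simp

text \<open>The usual value (e - 1) e (2e - 1) / 6, where 6 = 1.\<close>

lemma sum_squares_mod5:
  assumes "(5::'a::comm_ring_1) = 0"
  shows "(\<Sum>l\<in>{1..<e}. (of_nat l ^ 2 :: 'a)) = 2 * of_nat e ^ 3 - 3 * of_nat e ^ 2 + of_nat e"
proof (induction e)
  case (Suc e)
  show ?case
  proof (cases "e = 0")
    case False
    then have "{1..<Suc e} = insert e {1..<e}" by auto
    then have "(\<Sum>l\<in>{1..<Suc e}. (of_nat l ^ 2 :: 'a)) = of_nat e ^ 2 + (2 * of_nat e ^ 3 - 3 * of_nat e ^ 2 + of_nat e)"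
      using Suc by simp
    also have "\<dots> = 2 * of_nat (Suc e) ^ 3 - 3 * of_nat (Suc e) ^ 2 + of_nat (Suc e)"
      by (rule eq_mod5[OF assms, where c = "- (of_nat e ^ 2)"]) (simp add: algebra_simps power2_eq_square power3_eq_cube)
    finally show ?thesis .
  qed simp
qed simp

lemma divide_by_four:
  fixes s t :: "'a::comm_ring_1"
  assumes five: "(5::'a) = 0" and "4 * t = (2 - 2 * m) * s"
  shows "m * s = s - 2 * t"
proof (rule eq_mod5[OF five])
  have "m * s - (s - 2 * t) = 3 * (4 * t - (2 - 2 * m) * s) + 5 * (s - m * s - 2 * t)"
    by (simp add: algebra_simps)
  then show "m * s - (s - 2 * t) = 5 * (s - m * s - 2 * t)"
    using assms(2) by simp
qed

lemma qD_numeral: "qD (numeral k) = 0"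
  by (simp add: qD_def flip: numeral_fps_const)

lemma numeral_mult_nth: "fps_nth (numeral k * f) n = numeral k * fps_nth f n"
  by (simp add: numeral_fps_const)

lemma divide_by_four_shifted:
  fixes s t :: "'a::comm_ring_1"
  assumes five: "(5::'a) = 0" and "4 * s + 16 * t = l"
  shows "s = t - l"
proof (rule eq_mod5[OF five])
  show "s - (t - l) = 5 * (s + 3 * t)"
    using assms(2) by (simp add: algebra_simps)
qed

definition sig :: "5 fps" where
  "sig = Lam (\<lambda>e k. of_nat e)"

text \<open>Ramanujan's equation 12 D E_2 = E_2^2 - E_4 with E_4 = 1 and E_2 = 1 - 24
  \<open>sig\<close> = 1 + \<open>sig\<close> modulo 5. It comes from Liouville's identity for F l =
  l^2, as (a + b)^2 - (a - b)^2 = 4 a b; the cubes of divisors, which would form E_4, get the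
  coefficient 5.\<close>

lemma qD_sig: "qD sig = sig - 2 * sig ^ 2"
proof (rule fps_ext)
  fix n
  have "4 * fps_nth (sig * sig) n = (\<Sum>(a, x, b, y)\<in>quads n. 4 * (of_nat a * of_nat b))"
    unfolding sig_def Lam_mult_nth by (simp add: sum_distrib_left case_prod_unfold)
  also have "\<dots> = (\<Sum>(a, x, b, y)\<in>quads n. of_nat (a + b) ^ 2 - of_nat ((a - b) + (b - a)) ^ 2)"
  proof (intro sum.cong refl, clarify)
    fix a b :: nat
    have "of_nat ((a - b) + (b - a)) ^ 2 = (of_nat a - of_nat b :: 5) ^ 2"
      by (cases "a \<le> b") (simp_all add: of_nat_diff power2_commute)
    then show "4 * (of_nat a * of_nat b) = of_nat (a + b) ^ 2 - (of_nat ((a - b) + (b - a)) ^ 2 :: 5)"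
      by (simp add: power2_eq_square algebra_simps)
  qed
  also have "\<dots> = (\<Sum>(e, k)\<in>facs n. (of_nat e - 1) * of_nat e ^ 2 +
        2 * (\<Sum>l\<in>{1..<e}. of_nat l ^ 2) - 2 * ((of_nat k - 1) * of_nat e ^ 2))"
    by (rule liouville) simp
  also have "\<dots> = (\<Sum>(e, k)\<in>facs n. (2 - 2 * of_nat n) * of_nat e)"
  proof (intro sum.cong refl, clarify)
    fix e k assume "(e, k) \<in> facs n"
    then have n: "of_nat n = (of_nat e * of_nat k :: 5)" by (auto simp: facs_def)
    show "(of_nat e - 1) * of_nat e ^ 2 + 2 * (\<Sum>l\<in>{1..<e}. of_nat l ^ 2)
        - 2 * ((of_nat k - 1) * of_nat e ^ 2) = (2 - 2 * of_nat n) * (of_nat e :: 5)"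
      unfolding sum_squares_mod5[OF five] n
      by (rule eq_mod5[OF five, where c = "of_nat e ^ 3 - of_nat e ^ 2"])
         (simp add: algebra_simps power2_eq_square power3_eq_cube)
  qed
  also have "\<dots> = (2 - 2 * of_nat n) * fps_nth sig n"
    by (simp add: sig_def Lam_nth sum_distrib_left case_prod_unfold)
  finally have *: "4 * fps_nth (sig * sig) n = (2 - 2 * of_nat n) * fps_nth sig n" .
  have "of_nat n * fps_nth sig n = fps_nth sig n - 2 * fps_nth (sig * sig) n"
    using divide_by_four[OF five *] .
  then show "fps_nth (qD sig) n = fps_nth (sig - 2 * sig ^ 2) n"
    by (simp add: qD_nth power2_eq_square numeral_fps_const)
qed

section \<open>The substitution q -> q^d\<close>

definition dilate :: "nat \<Rightarrow> 'a::comm_ring_1 fps \<Rightarrow> 'a fps" where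
  "dilate d f = Abs_fps (\<lambda>n. if d dvd n then fps_nth f (n div d) else 0)"

lemma dilate_nth: "fps_nth (dilate d f) n = (if d dvd n then fps_nth f (n div d) else 0)"
  by (simp add: dilate_def)

lemma dilate_mult:
  assumes "0 < d"
  shows "dilate d (f * g) = dilate d f * dilate d g"
proof (rule fps_ext)
  fix n
  have "fps_nth (dilate d f * dilate d g) n =
        (\<Sum>i\<in>{i \<in> {0..n}. d dvd i \<and> d dvd n - i}. fps_nth f (i div d) * fps_nth g ((n - i) div d))"
    unfolding fps_mult_nth by (rule sum.mono_neutral_cong_right) (auto simp: dilate_nth)
  also have "\<dots> = fps_nth (dilate d (f * g)) n"
  proof (cases "d dvd n")
    case True
    then obtain m where n: "n = d * m" by blast
    have "(\<Sum>i\<in>{i \<in> {0..n}. d dvd i \<and> d dvd n - i}. fps_nth f (i div d) * fps_nth g ((n - i) div d)) =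
          (\<Sum>i\<in>{0..m}. fps_nth f i * fps_nth g (m - i))"
      by (rule sum.reindex_bij_witness[where i = "\<lambda>i. d * i" and j = "\<lambda>i. i div d"])
         (use assms n in \<open>auto elim!: dvdE simp flip: right_diff_distrib'\<close>)
    then show ?thesis
      using assms by (simp add: n dilate_nth fps_mult_nth)
  next
    case False
    then have "{i \<in> {0..n}. d dvd i \<and> d dvd n - i} = {}"
      by (metis (mono_tags, lifting) Collect_empty_eq atLeastAtMost_iff dvd_diffD)
    then show ?thesis
      using False by (simp only:) (simp add: dilate_nth)
  qed
  finally show "fps_nth (dilate d (f * g)) n = fps_nth (dilate d f * dilate d g) n" ..
qed

lemma dilate_add: "dilate d (f + g) = dilate d f + dilate d g"
  and dilate_diff: "dilate d (f - g) = dilate d f - dilate d g"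
  by (rule fps_ext; simp add: dilate_nth)+

lemma dilate_numeral_mult: "dilate d (numeral k * f) = numeral k * dilate d f"
  by (rule fps_ext) (simp add: dilate_nth numeral_fps_const)

lemma qD_dilate: "qD (dilate d f) = of_nat d * dilate d (qD f)"
proof (rule fps_ext)
  fix n
  have "fps_nth (of_nat d * dilate d (qD f)) n = of_nat d * fps_nth (dilate d (qD f)) n"
    by (metis fps_mult_left_const_nth fps_of_nat)
  then show "fps_nth (qD (dilate d f)) n = fps_nth (of_nat d * dilate d (qD f)) n"
    by (cases "d = 0") (auto simp: qD_nth dilate_nth elim!: dvdE)
qed

lemma Lam_dilate:
  assumes "0 < d"
  shows "dilate d (Lam f) = Lam (\<lambda>e k. if d dvd k then f e (k div d) else 0)"
proof (rule fps_ext)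
  fix n
  show "fps_nth (dilate d (Lam f)) n = fps_nth (Lam (\<lambda>e k. if d dvd k then f e (k div d) else 0)) n"
  proof (cases "d dvd n")
    case True
    then obtain m where n: "n = d * m" by blast
    have "(\<Sum>(e, k)\<in>facs n. if d dvd k then f e (k div d) else 0) =
          (\<Sum>(e, k)\<in>{(e, k) \<in> facs n. d dvd k}. f e (k div d))"
      by (rule sum.mono_neutral_cong_right) (auto simp: finite_facs split: if_splits)
    also have "\<dots> = (\<Sum>(e, k)\<in>facs m. f e k)"
      by (rule sum.reindex_bij_witness[where i = "\<lambda>(e, k). (e, d * k)" and j = "\<lambda>(e, k). (e, k div d)"])
         (use assms n in \<open>auto simp: facs_def elim!: dvdE\<close>)
    finally show ?thesis
      using assms n by (simp add: dilate_nth Lam_nth)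
  next
    case False
    then have "(\<Sum>(e, k)\<in>facs n. if d dvd k then f e (k div d) else 0) = 0"
      by (intro sum.neutral) (auto simp: facs_def)
    then show ?thesis
      using False assms by (simp add: dilate_nth Lam_nth)
  qed
qed

text \<open>A factor 2 moves from e to k without changing the exponent e k. Thus a series at q^2 can
  be read as a condition on either factor, which is how \<open>two_sig2\<close> becomes a sum over
  even divisors.\<close>

lemma Lam_even_shift:
  "Lam (\<lambda>e k. if even e then f (e div 2) (2 * k) else 0) = Lam (\<lambda>e k. if even k then f e k else 0)"
proof (rule fps_ext)
  fix n
  have "(\<Sum>(e, k)\<in>facs n. if even e then f (e div 2) (2 * k) else 0) =
        (\<Sum>(e, k)\<in>{(e, k) \<in> facs n. even e}. f (e div 2) (2 * k))"
    by (rule sum.mono_neutral_cong_right) (auto simp: finite_facs split: if_splits)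
  also have "\<dots> = (\<Sum>(e, k)\<in>{(e, k) \<in> facs n. even k}. f e k)"
    by (rule sum.reindex_bij_witness[where i = "\<lambda>(e, k). (2 * e, k div 2)" and j = "\<lambda>(e, k). (e div 2, 2 * k)"])
       (auto simp: facs_def elim!: evenE)
  also have "\<dots> = (\<Sum>(e, k)\<in>facs n. if even k then f e k else 0)"
    by (rule sum.mono_neutral_cong_left) (auto simp: finite_facs split: if_splits)
  finally show "fps_nth (Lam (\<lambda>e k. if even e then f (e div 2) (2 * k) else 0)) n =
                fps_nth (Lam (\<lambda>e k. if even k then f e k else 0)) n"
    by (simp add: Lam_nth)
qed

lemma Lam_add: "Lam f + Lam g = Lam (\<lambda>e k. f e k + g e k)"
  and Lam_diff: "Lam f - Lam g = Lam (\<lambda>e k. f e k - g e k)"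
  by (rule fps_ext; simp add: Lam_nth sum.distrib sum_subtractf case_prod_unfold)+

lemma Lam_numeral_mult: "numeral c * Lam f = Lam (\<lambda>e k. numeral c * f e k)"
  by (rule fps_ext) (simp add: Lam_nth sum_distrib_left case_prod_unfold numeral_fps_const)

lemma Lam_cong: "(\<And>e k. f e k = g e k) \<Longrightarrow> Lam f = Lam g"
  by (auto simp: Lam_def)

definition sig2 :: "5 fps" where "sig2 = dilate 2 sig"
definition sig4 :: "5 fps" where "sig4 = dilate 2 sig2"

lemma qD_sig2: "qD sig2 = 2 * sig2 + sig2 ^ 2"
proof -
  have "qD sig2 = 2 * dilate 2 (sig - 2 * sig ^ 2)"
    unfolding sig2_def by (subst qD_dilate) (simp add: qD_sig)
  also have "\<dots> = 2 * (sig2 - 2 * sig2 ^ 2)"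
    by (simp add: sig2_def dilate_diff dilate_numeral_mult dilate_mult power2_eq_square)
  also have "\<dots> = 2 * sig2 + sig2 ^ 2"
    by (rule eq_mod5[OF five_fps, where c = "- (sig2 ^ 2)"]) (simp add: algebra_simps)
  finally show ?thesis .
qed

lemma qD_sig4: "qD sig4 = 2 * sig4 ^ 2 - sig4"
proof -
  have "qD sig4 = 2 * dilate 2 (2 * sig2 + sig2 ^ 2)"
    unfolding sig4_def by (subst qD_dilate) (simp add: qD_sig2)
  also have "\<dots> = 2 * (2 * sig4 + sig4 ^ 2)"
    by (simp add: sig4_def dilate_add dilate_numeral_mult dilate_mult power2_eq_square)
  also have "\<dots> = 2 * sig4 ^ 2 - sig4"
    by (rule eq_mod5[OF five_fps, where c = "sig4"]) (simp add: algebra_simps)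
  finally show ?thesis .
qed

text \<open>The exact values are (e - 2)(e - 1) e / 6 for even e and (e - 1) e (e + 1) / 6 for odd
  e; again 6 = 1.\<close>

lemma sum_even_squares_mod5:
  fixes e :: nat
  assumes five: "(5::'a::comm_ring_1) = 0"
  shows "(\<Sum>l\<in>{1..<e}. if even l then of_nat l ^ 2 else 0) =
     (if even e then of_nat e ^ 3 - 3 * of_nat e ^ 2 + 2 * of_nat e else of_nat e ^ 3 - (of_nat e :: 'a))"
proof (induction e)
  case (Suc e)
  show ?case
  proof (cases "e = 0")
    case False
    then have *: "{1..<Suc e} = insert e {1..<e}" by auto
    show ?thesis
    proof (cases "even e")
      case True
      then have "(\<Sum>l\<in>{1..<Suc e}. if even l then of_nat l ^ 2 else 0 :: 'a) =
            of_nat e ^ 2 + (of_nat e ^ 3 - 3 * of_nat e ^ 2 + 2 * of_nat e)"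
        using Suc by (simp add: *)
      also have "\<dots> = of_nat (Suc e) ^ 3 - of_nat (Suc e)"
        by (rule eq_mod5[OF five, where c = "- (of_nat e ^ 2)"])
           (simp add: algebra_simps power2_eq_square power3_eq_cube)
      finally show ?thesis using True by simp
    next
      case odd: False
      then have "(\<Sum>l\<in>{1..<Suc e}. if even l then of_nat l ^ 2 else 0 :: 'a) = of_nat e ^ 3 - of_nat e"
        using Suc by (simp add: *)
      also have "\<dots> = of_nat (Suc e) ^ 3 - 3 * of_nat (Suc e) ^ 2 + 2 * of_nat (Suc e)"
        by (simp add: algebra_simps power2_eq_square power3_eq_cube)
      finally show ?thesis using odd by simp
    qed
  qed simp
qed simp

section \<open>Odd divisors and the level four relation\<close>

definition sig_odd :: "5 fps" where "sig_odd = Lam (\<lambda>e k. if odd e then of_nat e else 0)"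
definition sig_odd_odd :: "5 fps" where
  "sig_odd_odd = Lam (\<lambda>e k. if odd e \<and> odd k then of_nat e else 0)"

lemma sig2_Lam: "sig2 = Lam (\<lambda>e k. if even k then of_nat e else 0)"
  by (simp add: sig2_def sig_def Lam_dilate)

lemma two_sig2: "2 * sig2 = Lam (\<lambda>e k. if even e then of_nat e else 0)"
proof -
  have "Lam (\<lambda>e k. if even e then 2 * of_nat (e div 2) else 0 :: 5) = Lam (\<lambda>e k. if even k then 2 * of_nat e else 0)"
    by (rule Lam_even_shift[of "\<lambda>e k. 2 * of_nat e"])
  moreover have "Lam (\<lambda>e k. if even e then 2 * of_nat (e div 2) else 0 :: 5) = Lam (\<lambda>e k. if even e then of_nat e else 0)"
    by (rule Lam_cong) (auto elim!: evenE)
  moreover have "2 * sig2 = Lam (\<lambda>e k. if even k then 2 * of_nat e else 0)"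
    unfolding sig2_Lam Lam_numeral_mult by (rule Lam_cong) simp
  ultimately show ?thesis by simp
qed

lemma sig_odd_eq: "sig_odd = sig - 2 * sig2"
  unfolding sig_odd_def two_sig2 sig_def Lam_diff by (rule Lam_cong) simp

lemma dilate_sig_odd: "dilate 2 sig_odd = sig2 - 2 * sig4"
  unfolding sig_odd_eq dilate_diff dilate_numeral_mult sig2_def sig4_def ..

lemma sig_odd_odd_eq: "sig_odd_odd = sig_odd - dilate 2 sig_odd"
proof -
  have "dilate 2 sig_odd = Lam (\<lambda>e k. if even k then if odd e then of_nat e else 0 else 0)"
    unfolding sig_odd_def by (simp add: Lam_dilate)
  then show ?thesis
    unfolding sig_odd_odd_def by (simp only: sig_odd_def Lam_diff) (rule Lam_cong, simp)
qed

lemma sig_odd_odd_nth_even: "even n \<Longrightarrow> fps_nth sig_odd_odd n = 0"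
  unfolding sig_odd_odd_def Lam_nth by (rule sum.neutral) (auto simp: facs_def)

text \<open>\<open>sig_odd\<close> is the sum of \<open>sig_odd_odd\<close>, which has odd exponents
  only, and of its own dilation, which has even ones. In the square, the mixed term lives on odd
  exponents, so the even coefficients determine the square of \<open>sig_odd_odd\<close>.\<close>

lemma sig_odd_square_even:
  "fps_nth (sig_odd_odd ^ 2) n =
     (if even n then fps_nth (sig_odd ^ 2) n - fps_nth (sig_odd ^ 2) (n div 2) else 0)"
proof (cases "even n")
  case True
  have "sig_odd ^ 2 = sig_odd_odd ^ 2 + 2 * (sig_odd_odd * dilate 2 sig_odd) + dilate 2 (sig_odd ^ 2)"
    unfolding sig_odd_odd_eq power2_eq_square by (simp add: dilate_mult algebra_simps)
  moreover have "fps_nth (sig_odd_odd * dilate 2 sig_odd) n = 0"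
    unfolding fps_mult_nth using True
    by (intro sum.neutral) (auto simp: dilate_nth sig_odd_odd_nth_even)
  ultimately have "fps_nth (sig_odd ^ 2) n = fps_nth (sig_odd_odd ^ 2) n + fps_nth (dilate 2 (sig_odd ^ 2)) n"
    by (metis (no_types, lifting) fps_add_nth add.right_neutral mult_zero_right numeral_mult_nth)
  then show ?thesis
    using True by (simp add: dilate_nth)
next
  case False
  have "fps_nth (sig_odd_odd ^ 2) n = 0"
    unfolding power2_eq_square fps_mult_nth
  proof (intro sum.neutral ballI)
    fix i assume i: "i \<in> {0..n}"
    show "fps_nth sig_odd_odd i * fps_nth sig_odd_odd (n - i) = 0"
      using False i by (cases "even i") (simp_all add: sig_odd_odd_nth_even)
  qed
  with False show ?thesis by simp
qed

text \<open>Liouville's identity for l^2 restricted to even l. As a + b and a - b have the same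
  parity, the left side keeps the pairs a, b of equal parity: odd pairs give the square of
  \<open>sig_odd\<close>, even pairs that of 2 \<open>sig2\<close>.\<close>

lemma sig_odd_square_nth:
  "fps_nth (sig_odd ^ 2) n =
     fps_nth (sig2 ^ 2) n - (\<Sum>(e, k)\<in>facs n. if even e then 3 * of_nat e ^ 3 + 4 * of_nat e - 2 * of_nat n * of_nat e
                                else 2 * (of_nat e ^ 3 - of_nat e))"
proof -
  define F :: "nat \<Rightarrow> 5" where "F = (\<lambda>l. if even l then of_nat l ^ 2 else 0)"
  have *: "F (a + b) - F ((a - b) + (b - a)) =
      4 * ((if odd a then of_nat a else 0) * (if odd b then of_nat b else 0)) +
      4 * ((if even a then of_nat a else 0) * (if even b then of_nat b else 0))" for a b
  proof -
    have "of_nat ((a - b) + (b - a)) ^ 2 = (of_nat a - of_nat b :: 5) ^ 2"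
      by (cases "a \<le> b") (simp_all add: of_nat_diff power2_commute)
    moreover have "even ((a - b) + (b - a)) \<longleftrightarrow> even (a + b)"
      by (cases "a \<le> b") auto
    ultimately show ?thesis
      by (auto simp: F_def power2_eq_square algebra_simps)
  qed
  have "4 * fps_nth (sig_odd * sig_odd) n + 4 * fps_nth ((2 * sig2) * (2 * sig2)) n =
        (\<Sum>(a, x, b, y)\<in>quads n. F (a + b) - F ((a - b) + (b - a)))"
    unfolding two_sig2 unfolding sig_odd_def Lam_mult_nth *
    by (simp add: sum.distrib sum_distrib_left case_prod_unfold)
  also have "\<dots> = (\<Sum>(e, k)\<in>facs n. (of_nat e - 1) * F e + 2 * (\<Sum>l\<in>{1..<e}. F l)
                              - 2 * ((of_nat k - 1) * F e))"
    by (rule liouville) (simp add: F_def)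
  also have "\<dots> = (\<Sum>(e, k)\<in>facs n. if even e then 3 * of_nat e ^ 3 + 4 * of_nat e - 2 * of_nat n * of_nat e
                                else 2 * (of_nat e ^ 3 - of_nat e))" (is "_ = ?L")
  proof (intro sum.cong refl, clarify)
    fix e k assume "(e, k) \<in> facs n"
    then have n: "of_nat n = (of_nat e * of_nat k :: 5)" by (auto simp: facs_def)
    show "(of_nat e - 1) * F e + 2 * (\<Sum>l\<in>{1..<e}. F l) - 2 * ((of_nat k - 1) * F e) =
      (if even e then 3 * of_nat e ^ 3 + 4 * of_nat e - 2 * of_nat n * of_nat e
                                else 2 * (of_nat e ^ 3 - of_nat e))"
    proof (cases "even e")
      case True
      have "(of_nat e - 1) * of_nat e ^ 2 + 2 * (of_nat e ^ 3 - 3 * of_nat e ^ 2 + 2 * of_nat e)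
          - 2 * ((of_nat k - 1) * of_nat e ^ 2) =
          3 * of_nat e ^ 3 + 4 * of_nat e - 2 * of_nat n * (of_nat e :: 5)"
        unfolding n
        by (rule eq_mod5[OF five, where c = "- (of_nat e ^ 2)"])
           (simp add: algebra_simps power2_eq_square power3_eq_cube)
      then show ?thesis
        unfolding F_def sum_even_squares_mod5[OF five] using True by simp
    next
      case False
      then show ?thesis
        unfolding F_def sum_even_squares_mod5[OF five] by simp
    qed
  qed
  finally have "4 * fps_nth (sig_odd * sig_odd) n + 16 * fps_nth (sig2 * sig2) n = ?L"
    by (simp add: numeral_fps_const mult.assoc mult.left_commute[of sig2])
  then have "fps_nth (sig_odd * sig_odd) n = fps_nth (sig2 * sig2) n - ?L"
    by (rule divide_by_four_shifted[OF five])
  then show ?thesis by (simp add: power2_eq_square)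
qed

lemma sum_facs_double:
  "(\<Sum>(e, k)\<in>facs (2 * n). f e) =
   (\<Sum>(e, k)\<in>facs n. f (2 * e) + (if odd e then f e else (0::'a::comm_ring_1)))"
proof -
  have "facs (2 * n) = {(e, k) \<in> facs (2 * n). even e} \<union> {(e, k) \<in> facs (2 * n). odd e}" by auto
  then have "(\<Sum>(e, k)\<in>facs (2 * n). f e) =
      (\<Sum>(e, k)\<in>{(e, k) \<in> facs (2 * n). even e} \<union> {(e, k) \<in> facs (2 * n). odd e}. f e)" by simp
  also have "\<dots> = (\<Sum>(e, k)\<in>{(e, k) \<in> facs (2 * n). even e}. f e)
      + (\<Sum>(e, k)\<in>{(e, k) \<in> facs (2 * n). odd e}. f e)"
    by (rule sum.union_disjoint) (auto intro: finite_subset[OF _ finite_facs])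
  also have "(\<Sum>(e, k)\<in>{(e, k) \<in> facs (2 * n). even e}. f e) = (\<Sum>(e, k)\<in>facs n. f (2 * e))"
    by (rule sum.reindex_bij_witness[where i = "\<lambda>(e, k). (2 * e, k)" and j = "\<lambda>(e, k). (e div 2, k)"])
       (auto simp: facs_def)
  also have "(\<Sum>(e, k)\<in>{(e, k) \<in> facs (2 * n). odd e}. f e) = (\<Sum>(e, k)\<in>{(e, k) \<in> facs n. odd e}. f e)"
  proof (rule sum.reindex_bij_witness[where i = "\<lambda>(e, k). (e, 2 * k)" and j = "\<lambda>(e, k). (e, k div 2)"])
    fix p assume p: "p \<in> {(e, k) \<in> facs (2 * n). odd e}"
    then obtain e k where ek: "p = (e, k)" "odd e" "0 < e" "0 < k" "e * k = 2 * n"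
      by (auto simp: facs_def)
    then have "even k" by (metis dvd_triv_left even_mult_iff)
    then obtain m where "k = 2 * m" by blast
    with ek show "(case case p of (e, k) \<Rightarrow> (e, k div 2) of (e, k) \<Rightarrow> (e, 2 * k)) = p"
      "(case p of (e, k) \<Rightarrow> (e, k div 2)) \<in> {(e, k) \<in> facs n. odd e}"
      "(case case p of (e, k) \<Rightarrow> (e, k div 2) of (e, k) \<Rightarrow> f e) = (case p of (e, k) \<Rightarrow> f e)"
      by (auto simp: facs_def)
  qed (auto simp: facs_def)
  also have "\<dots> = (\<Sum>(e, k)\<in>facs n. if odd e then f e else 0)"
    by (rule sum.mono_neutral_cong_left) (auto simp: finite_facs split: if_splits)
  finally show ?thesis by (simp add: sum.distrib case_prod_unfold)
qed

text \<open>Ramanujan's equation read backwards. It linearizes the remaining square, so that the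
  level four relation becomes a comparison of divisor sums.\<close>

lemma sig2_square_nth: "fps_nth (sig2 ^ 2) n = (of_nat n - 2) * fps_nth sig2 n"
proof -
  have "fps_nth (qD sig2) n = 2 * fps_nth sig2 n + fps_nth (sig2 ^ 2) n"
    unfolding qD_sig2 by (simp add: numeral_mult_nth)
  then show ?thesis by (simp add: qD_nth algebra_simps)
qed

lemma sig2_nth: "fps_nth sig2 n = (\<Sum>(e, k)\<in>facs n. if even e then 3 * of_nat e else 0)"
proof -
  have "sig2 = 3 * (2 * sig2)"
    by (rule eq_mod5[OF five_fps, where c = "- sig2"]) (simp add: algebra_simps)
  also have "\<dots> = Lam (\<lambda>e k. if even e then 3 * of_nat e else 0)"
    unfolding two_sig2 Lam_numeral_mult by (rule Lam_cong) simp
  finally have *: "sig2 = Lam (\<lambda>e k. if even e then 3 * of_nat e else 0)" .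
  show ?thesis by (subst *) (simp only: Lam_nth)
qed

text \<open>
  With $B$ = \<open>dilate 2 sig_odd\<close> and $C$ = \<open>sig_odd_odd\<close> one has
  $E_4(q^2) = (1 + 24 B)^2 + 192\, C^2$, and $E_4 \equiv 1$ modulo 5.
\<close>

lemma level_four_relation:
  "3 * dilate 2 sig_odd + dilate 2 sig_odd ^ 2 + 2 * sig_odd_odd ^ 2 = 0"
proof (rule fps_ext)
  fix n
  have sq: "dilate 2 sig_odd ^ 2 = dilate 2 (sig_odd ^ 2)"
    by (simp add: power2_eq_square dilate_mult)
  show "fps_nth (3 * dilate 2 sig_odd + dilate 2 sig_odd ^ 2 + 2 * sig_odd_odd ^ 2) n = fps_nth 0 n"
  proof (cases "even n")
    case False
    then show ?thesis
      by (simp add: numeral_mult_nth sig_odd_square_even dilate_nth sq)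
  next
    case True
    then obtain m where n: "n = 2 * m" by blast
    let ?L = "\<lambda>n e. if even e then 3 * of_nat e ^ 3 + 4 * of_nat e - 2 * of_nat n * of_nat e
                                else 2 * (of_nat e ^ 3 - of_nat e) :: 5"
    have "fps_nth (3 * dilate 2 sig_odd + dilate 2 sig_odd ^ 2 + 2 * sig_odd_odd ^ 2) n =
       3 * fps_nth sig_odd m - fps_nth (sig_odd ^ 2) m + 2 * fps_nth (sig_odd ^ 2) (2 * m)"
      by (simp add: n numeral_mult_nth sig_odd_square_even dilate_nth sq)
    also have "\<dots> = (\<Sum>(e, k)\<in>facs m.
        3 * (if odd e then of_nat e else 0)
        - ((of_nat m - 2) * (if even e then 3 * of_nat e else 0) - ?L m e)
        + 2 * ((of_nat (2 * m) - 2) * of_nat e - (?L (2 * m) (2 * e) + (if odd e then ?L (2 * m) e else 0))))"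
    proof -
      have "fps_nth sig2 (2 * m) = (\<Sum>(e, k)\<in>facs m. of_nat e)"
        by (simp add: sig2_def dilate_nth sig_def Lam_nth)
      moreover have "fps_nth sig_odd m = (\<Sum>(e, k)\<in>facs m. if odd e then of_nat e else 0)"
        by (simp add: sig_odd_def Lam_nth)
      ultimately show ?thesis
        unfolding sig_odd_square_nth sig2_square_nth sum_facs_double sig2_nth[of m]
        by (simp only: sum_subtractf sum.distrib sum_distrib_left case_prod_unfold right_diff_distrib distrib_left)
    qed
    \<comment> \<open>Different divisors need not interact: for each e, whether even or odd, the
      summand is a multiple of 5.\<close>
    also have "\<dots> = 0"
    proof (rule sum.neutral, clarify)
      fix e :: nat
      show "3 * (if odd e then of_nat e else 0)
        - ((of_nat m - 2) * (if even e then 3 * of_nat e else 0) - ?L m e)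
        + 2 * ((of_nat (2 * m) - 2) * of_nat e - (?L (2 * m) (2 * e) + (if odd e then ?L (2 * m) e else 0))) = (0::5)"
      proof (cases "even e")
        case True
        have "- ((of_nat m - 2) * (3 * of_nat e) - (3 * of_nat e ^ 3 + 4 * of_nat e - 2 * of_nat m * of_nat e))
            + 2 * ((2 * of_nat m - 2) * of_nat e - (3 * (2 * of_nat e) ^ 3 + 4 * (2 * of_nat e)
                - 2 * (2 * of_nat m) * (2 * of_nat e))) = (0::5)"
          by (rule eq_mod5[OF five, where c = "- 9 * of_nat e ^ 3 - 2 * of_nat e + 3 * of_nat m * of_nat e"])
             (simp add: algebra_simps power2_eq_square power3_eq_cube)
        then show ?thesis using True by simp
      next
        case False
        have "3 * of_nat e + 2 * (of_nat e ^ 3 - of_nat e)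
            + 2 * ((2 * of_nat m - 2) * of_nat e - (3 * (2 * of_nat e) ^ 3 + 4 * (2 * of_nat e)
                - 2 * (2 * of_nat m) * (2 * of_nat e) + 2 * (of_nat e ^ 3 - of_nat e))) = (0::5)"
          by (rule eq_mod5[OF five, where c = "- 10 * of_nat e ^ 3 - 3 * of_nat e + 4 * of_nat m * of_nat e"])
             (simp add: algebra_simps power2_eq_square power3_eq_cube)
        then show ?thesis using False by simp
      qed
    qed
    finally show ?thesis by simp
  qed
qed

lemma level_four_relation':
  "3 * (sig2 - 2 * sig4) + (sig2 - 2 * sig4) ^ 2 + 2 * (sig - 3 * sig2 + 2 * sig4) ^ 2 = 0"
  using level_four_relation unfolding sig_odd_odd_eq unfolding dilate_sig_odd unfolding sig_odd_eq
  by (simp add: algebra_simps)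

text \<open>
  A quadratic ansatz in the three series, with coefficients solved for so that \<open>lift_form_identity\<close>
  holds modulo the level four relation.
\<close>

definition lift_form :: "5 fps" where
  "lift_form = 4 * sig4 ^ 2 + 3 * sig2 + 3 * sig2 * sig4 + 4 * sig + 4 * sig * sig4 + 2 * sig * sig2 + 4 * sig ^ 2"

lemma lift_form_polynomial_identity:
  fixes x r s x' r' s' :: "'a::comm_ring_1"
  assumes five: "(5::'a) = 0"
    and x': "x' = x - 2 * x ^ 2" and r': "r' = 2 * r + r ^ 2" and s': "s' = 2 * s ^ 2 - s"
    and rel: "3 * (r - 2 * s) + (r - 2 * s) ^ 2 + 2 * (x - 3 * r + 2 * s) ^ 2 = 0"
  shows "((x' + r') + (x + r) ^ 2) * (s - 1) + (x + r) - 2 * s - (1 + (x + r)) * s' - (4 * s * s' - s') =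
     (8 * s * s' + 3 * r' + 3 * (r' * s + r * s') + 4 * x' + 4 * (x' * s + x * s') + 2 * (x' * r + x * r') + 8 * x * x')
     - (x + r + 1) * (4 * s ^ 2 + 3 * r + 3 * r * s + 4 * x + 4 * x * s + 2 * x * r + 4 * x ^ 2)"
    (is "?l = ?r")
proof -
  let ?R = "3 * (r - 2 * s) + (r - 2 * s) ^ 2 + 2 * (x - 3 * r + 2 * s) ^ 2"
  \<comment> \<open>The difference lies in the ideal generated by the level four relation and 5;
    these are its cofactors.\<close>
  have "?l - ?r = (2 + 3 * s) * ?R + 5 * (2 * s + 2 * s^2 - 12 * s^3 - 2 * r + 10 * r * s + 16 * r * s^2 - 8 * r^2
     - 11 * r^2 * s - 2 * x * s - 6 * x * s^2 + 5 * x * r + 9 * x * r * s + x^2 + x^2 * s + 2 * x^2 * r + 4 * x^3)"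
    unfolding x' r' s' by (simp add: algebra_simps power2_eq_square power3_eq_cube)
  then have "?l - ?r = 0"
    unfolding rel five by simp
  then show ?thesis by (simp only: right_minus_eq)
qed

text \<open>For u = D psi / psi, the left side is what \<open>weighted_series_identity\<close>
  leaves beside the \<open>cub4\<close> terms after division by 2 psi. The right side is D(PY) - PY
  divided by P, for Y = \<open>lift_form\<close>.\<close>

lemma lift_form_identity:
  defines "u \<equiv> sig + sig2"
  shows "(qD u + u ^ 2) * (sig4 - 1) + u - 2 * sig4 - (1 + u) * qD sig4 - qD (qD sig4) =
         qD lift_form - u * lift_form - lift_form"
proof -
  have d4: "qD (qD sig4) = 4 * sig4 * qD sig4 - qD sig4"
  proof -
    have "qD (qD sig4) = qD (2 * sig4 ^ 2 - sig4)" by (rule arg_cong[OF qD_sig4])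
    also have "\<dots> = 4 * sig4 * qD sig4 - qD sig4"
      by (simp add: qD_diff qD_numeral_mult power2_eq_square qD_mult qD_numeral)
    finally show ?thesis .
  qed
  have dY: "qD lift_form = 8 * sig4 * qD sig4 + 3 * qD sig2 + 3 * (qD sig2 * sig4 + sig2 * qD sig4) + 4 * qD sig
      + 4 * (qD sig * sig4 + sig * qD sig4) + 2 * (qD sig * sig2 + sig * qD sig2) + 8 * sig * qD sig"
    by (simp add: lift_form_def qD_add qD_numeral_mult power2_eq_square qD_mult qD_numeral algebra_simps)
  show ?thesis
    unfolding d4 dY u_def qD_add
    using lift_form_polynomial_identity[OF five_fps qD_sig qD_sig2 qD_sig4 level_four_relation']
    by (simp add: lift_form_def algebra_simps)
qed

subsection \<open>A weighted lattice sum\<close>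

lemma forall_mod5: "(\<forall>x::5. Q x) \<longleftrightarrow> Q 0 \<and> Q 1 \<and> Q 2 \<and> Q 3 \<and> Q 4"
proof -
  have "Q x" if "Q 0 \<and> Q 1 \<and> Q 2 \<and> Q 3 \<and> Q 4" for x
  proof (cases x)
    case (of_int z)
    then consider "z = 0" | "z = 1" | "z = 2" | "z = 3" | "z = 4" by fastforce
    then show ?thesis using of_int(1) that by cases (simp_all only: of_int_0 of_int_1 of_int_numeral)
  qed
  then show ?thesis by blast
qed

lemma fermat_mod5: "(x::5) ^ 5 = x"
proof -
  have "\<forall>x::5. x ^ 5 = x" unfolding forall_mod5 by simp
  then show ?thesis by blast
qed

lemma double_eq_0_mod5: "(x::5) + x = 0 \<Longrightarrow> x = 0"
proof -
  have "\<forall>x::5. x + x = 0 \<longrightarrow> x = 0" unfolding forall_mod5 by simp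
  then show "x + x = 0 \<Longrightarrow> x = 0" by blast
qed

section \<open>Triangular numbers and the theta series psi\<close>

definition tri :: "nat \<Rightarrow> nat" where "tri i = i * (i + 1) div 2"

lemma two_tri: "2 * tri i = i * (i + 1)"
  by (simp add: tri_def)

lemma le_tri: "i \<le> tri i"
  using two_tri[of i] by (cases i) auto

lemma tri_strict_mono: "i < j \<Longrightarrow> tri i < tri j"
proof (induction j)
  case (Suc j)
  have "tri j < tri (Suc j)"
    using two_tri[of j] two_tri[of "Suc j"] by simp
  with Suc show ?case by (cases "i = j") auto
qed simp

lemma tri_eq_iff: "tri i = tri j \<longleftrightarrow> i = j"
  using tri_strict_mono by (metis less_irrefl linorder_neqE_nat)

lemma finite_tri_le: "finite {i. tri i \<le> n}"
  by (rule finite_subset[of _ "{..n}"]) (auto intro: order_trans[OF le_tri])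

definition psi :: "'a::comm_ring_1 fps" where
  "psi = Abs_fps (\<lambda>n. if n \<in> range tri then 1 else 0)"

text \<open>One statement for psi, D psi and D^2 psi, with g the zeroth, first and second power; the
  derivatives of psi thus encode the powers of T = \<open>tri i\<close>.\<close>

lemma tri_series_mult_nth:
  fixes f A :: "'a::comm_ring_1 fps"
  assumes "\<And>n. fps_nth f n = (if n \<in> range tri then g n else 0)"
  shows "fps_nth (f * A) n = (\<Sum>i\<in>{i. tri i \<le> n}. g (tri i) * fps_nth A (n - tri i))"
proof -
  have "fps_nth (f * A) n = (\<Sum>m\<in>tri ` {i. tri i \<le> n}. g m * fps_nth A (n - m))"
    unfolding fps_mult_nth by (rule sum.mono_neutral_cong_right) (auto simp: assms)
  also have "\<dots> = (\<Sum>i\<in>{i. tri i \<le> n}. g (tri i) * fps_nth A (n - tri i))"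
    by (subst sum.reindex) (auto simp: inj_on_def tri_eq_iff)
  finally show ?thesis .
qed

lemma psi_nth: "fps_nth psi n = (if n \<in> range tri then 1 else 0)"
  by (simp add: psi_def)

text \<open>
  The cubic is chosen for \<open>weight_convert\<close>: there the factor in front of \<open>cubic_weight X\<close> on the right is
  $t^2 - y^2$ for $y^2 = 8T + 1$, $x = X$ and $t^2 - x^2 = 8D$.
\<close>

definition cubic_weight :: "5 \<Rightarrow> 5" where
  "cubic_weight x = 2 * x - x ^ 3"

text \<open>The congruences leave one choice of sign for y, make (t - x)/4 and (x - y)/4 integers,
  and are preserved by both symmetries.\<close>

definition lat :: "int \<Rightarrow> (int \<times> int \<times> int) set" where
  "lat M = {(y, t, x). odd x \<and> 4 dvd y - x \<and> 4 dvd t - x \<and> y\<^sup>2 + t\<^sup>2 - x\<^sup>2 = M}"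

definition latf :: "int \<Rightarrow> int \<Rightarrow> int \<Rightarrow> 5" where
  "latf y t x = of_int (t\<^sup>2 - y\<^sup>2) * cubic_weight (of_int x)"

lemma latf_swap: "- latf t y x = latf y t x"
  by (simp add: latf_def algebra_simps)

lemma latf_reflect: "latf (- t) (- y) (- x) = latf y t x"
  by (simp add: latf_def cubic_weight_def algebra_simps)

lemma lat_swap: "(y, t, x) \<in> lat M \<longleftrightarrow> (t, y, x) \<in> lat M"
  by (auto simp: lat_def)

lemma lat_reflect: "(- t, - y, - x) \<in> lat M \<longleftrightarrow> (y, t, x) \<in> lat M"
proof -
  have "4 dvd - t - - x \<longleftrightarrow> 4 dvd t - x" "4 dvd - y - - x \<longleftrightarrow> 4 dvd y - x"
    using dvd_minus_iff[of 4 "t - x"] dvd_minus_iff[of 4 "y - x"] by simp_all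
  then show ?thesis by (auto simp: lat_def)
qed

text \<open>The form is indefinite, but 0 < x < t gives t^2 - x^2 \<ge> 2t - 1, and this bounds all
  coordinates by M.\<close>

lemma finite_lat_pos: "finite {(y, t, x) \<in> lat M. 0 < x \<and> x < t}"
proof (rule finite_subset)
  have *: "\<bar>y\<bar> \<le> M \<and> t \<le> M" if "0 < x" "x < t" "y\<^sup>2 + t\<^sup>2 - x\<^sup>2 = M" for y t x :: int
  proof -
    have "x\<^sup>2 \<le> (t - 1)\<^sup>2" using that by (intro power_mono) auto
    then have *: "t\<^sup>2 - x\<^sup>2 \<ge> 2 * t - 1" by (simp add: power2_eq_square algebra_simps)
    moreover have "\<bar>y\<bar> \<le> y\<^sup>2"
    proof (cases "y = 0")
      case False
      then have "\<bar>y\<bar> * 1 \<le> \<bar>y\<bar> * \<bar>y\<bar>" by (intro mult_left_mono) auto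
      then show ?thesis by (simp add: power2_eq_square)
    qed simp
    ultimately show ?thesis using that by auto
  qed
  show "{(y, t, x) \<in> lat M. 0 < x \<and> x < t} \<subseteq> {-M..M} \<times> {-M..M} \<times> {-M..M}"
  proof clarify
    fix y t x assume "(y, t, x) \<in> lat M" "0 < x" "x < t"
    with *[of x t y] show "y \<in> {-M..M} \<and> (t, x) \<in> {-M..M} \<times> {-M..M}"
      by (auto simp: lat_def simp del: add_diff_eq)
  qed
qed auto

lemma lat_sum_swap_eq_0:
  "(\<Sum>(y, t, x)\<in>{(y, t, x) \<in> lat M. 0 < x \<and> x < t \<and> x < y}. latf y t x) = 0" (is "?S = 0")
proof -
  have "?S = (\<Sum>(y, t, x)\<in>{(y, t, x) \<in> lat M. 0 < x \<and> x < t \<and> x < y}. - latf y t x)"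
    by (rule sum.reindex_bij_witness[where i = "\<lambda>(y, t, x). (t, y, x)" and j = "\<lambda>(y, t, x). (t, y, x)"])
       (auto simp: latf_swap lat_swap)
  also have "\<dots> = - ?S"
    by (simp only: sum_negf case_prod_unfold)
  finally have "?S + ?S = 0"
    by (simp only: eq_neg_iff_add_eq_0)
  then show ?thesis by (rule double_eq_0_mod5)
qed

lemma lat_sum_reflect:
  "(\<Sum>(y, t, x)\<in>{(y, t, x) \<in> lat M. x < 0 \<and> y < x \<and> x < t}. latf y t x) =
   (\<Sum>(y, t, x)\<in>{(y, t, x) \<in> lat M. 0 < x \<and> x < t \<and> y < x}. latf y t x)"
  by (rule sum.reindex_bij_witness[where i = "\<lambda>(y, t, x). (- t, - y, - x)" and j = "\<lambda>(y, t, x). (- t, - y, - x)"])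
     (auto simp: latf_reflect lat_reflect)

lemma finite_lat_neg: "finite {(y, t, x) \<in> lat M. x < 0 \<and> y < x \<and> x < t}"
proof -
  have fin: "finite {(y, t, x) \<in> lat M. 0 < x \<and> x < t \<and> y < x}"
    by (rule finite_subset[OF _ finite_lat_pos[of M]]) auto
  have "{(y, t, x) \<in> lat M. x < 0 \<and> y < x \<and> x < t} \<subseteq>
        (\<lambda>(y, t, x). (- t, - y, - x)) ` {(y, t, x) \<in> lat M. 0 < x \<and> x < t \<and> y < x}"
  proof clarify
    fix y t x assume "(y, t, x) \<in> lat M" "x < 0" "y < x" "x < t"
    then show "(y, t, x) \<in> (\<lambda>(y, t, x). (- t, - y, - x)) ` {(y, t, x) \<in> lat M. 0 < x \<and> x < t \<and> y < x}"
      by (intro image_eqI[of _ _ "(- t, - y, - x)"]) (auto simp: lat_reflect)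
  qed
  then show ?thesis
    using fin by (rule finite_surj[rotated])
qed

lemma lat_sum_middle:
  "(\<Sum>(y, t, x)\<in>{(y, t, x) \<in> lat M. y < x \<and> x < t}. latf y t x) =
   2 * (\<Sum>(y, t, x)\<in>{(y, t, x) \<in> lat M. 0 < x \<and> x < t \<and> y < x}. latf y t x)"
proof -
  have fin: "finite {(y, t, x) \<in> lat M. 0 < x \<and> x < t \<and> y < x}"
    by (rule finite_subset[OF _ finite_lat_pos[of M]]) auto
  have x0: "(y, t, x) \<in> lat M \<Longrightarrow> x < 0 \<or> 0 < x" for y t x
    by (cases "x = 0") (auto simp: lat_def)
  have "{(y, t, x) \<in> lat M. y < x \<and> x < t} =
        {(y, t, x) \<in> lat M. x < 0 \<and> y < x \<and> x < t} \<union> {(y, t, x) \<in> lat M. 0 < x \<and> x < t \<and> y < x}"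
    using x0 by blast
  then have "(\<Sum>(y, t, x)\<in>{(y, t, x) \<in> lat M. y < x \<and> x < t}. latf y t x) =
      (\<Sum>(y, t, x)\<in>{(y, t, x) \<in> lat M. x < 0 \<and> y < x \<and> x < t}. latf y t x) +
      (\<Sum>(y, t, x)\<in>{(y, t, x) \<in> lat M. 0 < x \<and> x < t \<and> y < x}. latf y t x)"
    by (simp only:) (rule sum.union_disjoint[OF finite_lat_neg fin], auto)
  then show ?thesis
    unfolding lat_sum_reflect by simp
qed

text \<open>The part y > x cancels and the part y < x is half of the region y < x < t; the factor 2
  is kept in place of this division. The points with y = x are fixed by neither argument and remain
  as a separate sum.\<close>

lemma lattice_sum:
  "2 * (\<Sum>(y, t, x)\<in>{(y, t, x) \<in> lat M. 0 < x \<and> x < t}. latf y t x) =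
     (\<Sum>(y, t, x)\<in>{(y, t, x) \<in> lat M. y < x \<and> x < t}. latf y t x) +
     2 * (\<Sum>(y, t, x)\<in>{(y, t, x) \<in> lat M. 0 < x \<and> x < t \<and> y = x}. latf y t x)"
proof -
  have "(\<Sum>(y, t, x)\<in>{(y, t, x) \<in> lat M. 0 < x \<and> x < t}. latf y t x) =
      (\<Sum>(y, t, x)\<in>{(y, t, x) \<in> lat M. 0 < x \<and> x < t \<and> y < x}. latf y t x) +
      (\<Sum>(y, t, x)\<in>{(y, t, x) \<in> lat M. 0 < x \<and> x < t \<and> x < y}. latf y t x) +
      (\<Sum>(y, t, x)\<in>{(y, t, x) \<in> lat M. 0 < x \<and> x < t \<and> y = x}. latf y t x)"
    using sum_trichotomy[OF finite_lat_pos, of "\<lambda>(y, t, x). latf y t x" M "\<lambda>(y, t, x). y" "\<lambda>(y, t, x). x"]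
    by (simp add: case_prod_unfold conj_assoc)
  then show ?thesis
    unfolding lat_sum_swap_eq_0 lat_sum_middle by (simp add: distrib_left)
qed

section \<open>The Lambert series over the cone 2n < d\<close>

definition X1 :: "5 fps" where
  "X1 = Lam (\<lambda>n d. if odd d \<and> 2 * n < d then of_nat (d - 2 * n) else 0)"

text \<open>The correction that gives \<open>X1\<close> a symmetry: the same cone, with the cubic
  weight instead of the linear one. Here d - 2n is the coordinate x.\<close>

definition W0 :: "5 fps" where
  "W0 = Lam (\<lambda>n d. if odd d \<and> 2 * n < d then cubic_weight (of_nat (d - 2 * n)) else 0)"

definition cub4 :: "5 fps" where
  "cub4 = dilate 4 (Lam (\<lambda>e k. of_nat e ^ 3))"

definition prs :: "nat \<Rightarrow> (nat \<times> nat) set" where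
  "prs n = {(p, r). 0 < p \<and> 0 < r \<and> 4 * (p * r) = n}"

lemma prs_eq: "prs n = (if 4 dvd n then facs (n div 4) else {})"
  by (auto simp: prs_def facs_def)

lemma finite_prs: "finite (prs n)"
  by (simp add: prs_eq finite_facs)

lemma dilate4_nth: "fps_nth (dilate 4 (Lam f)) n = (\<Sum>(p, r)\<in>prs n. f p r)"
  by (simp add: dilate_nth Lam_nth prs_eq)

lemma sig4_eq: "sig4 = dilate 4 (Lam (\<lambda>e k. of_nat e))"
proof (rule fps_ext)
  fix n
  show "fps_nth sig4 n = fps_nth (dilate 4 (Lam (\<lambda>e k. of_nat e))) n"
    unfolding sig4_def sig2_def sig_def
    by (auto simp: dilate_nth)
qed

lemma psi_mult_nth: "fps_nth (psi * A) n = (\<Sum>i\<in>{i. tri i \<le> n}. fps_nth A (n - tri i))"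
  using tri_series_mult_nth[of psi "\<lambda>_. 1"] by (simp add: psi_nth)

lemma qD_psi_mult_nth:
  "fps_nth (qD psi * A) n = (\<Sum>i\<in>{i. tri i \<le> n}. of_nat (tri i) * fps_nth A (n - tri i))"
  by (rule tri_series_mult_nth) (simp add: psi_nth qD_nth)

lemma qD2_psi_mult_nth:
  "fps_nth (qD (qD psi) * A) n = (\<Sum>i\<in>{i. tri i \<le> n}. of_nat (tri i) ^ 2 * fps_nth A (n - tri i))"
  by (rule tri_series_mult_nth) (simp add: psi_nth qD_nth power2_eq_square)

lemma tri_int: "8 * int (tri i) + 1 = (2 * int i + 1)\<^sup>2"
proof -
  have "int (2 * tri i) = int (i * (i + 1))" by (simp only: two_tri)
  then show ?thesis by (simp add: power2_eq_square algebra_simps)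
qed

lemma weight_convert:
  fixes T D X :: 5
  shows "(D - 1 - T) * cubic_weight X + X = 2 * ((X ^ 2 + 8 * D - 1 - 8 * T) * cubic_weight X)"
proof (rule eq_mod5[OF five])
  \<comment> \<open>Apart from multiples of 5 only 2 (X^5 - X) remains, and Fermat's congruence
    removes it.\<close>
  have "(D - 1 - T) * cubic_weight X + X - 2 * ((X ^ 2 + 8 * D - 1 - 8 * T) * cubic_weight X) =
     5 * ((3 * T - 3 * D) * cubic_weight X + X - X ^ 3) + 2 * (X ^ 5 - X)"
    by (simp add: cubic_weight_def algebra_simps power2_eq_square power3_eq_cube power_numeral_reduce)
  then show "(D - 1 - T) * cubic_weight X + X - 2 * ((X ^ 2 + 8 * D - 1 - 8 * T) * cubic_weight X) =
     5 * ((3 * T - 3 * D) * cubic_weight X + X - X ^ 3)"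
    by (simp add: fermat_mod5)
qed

text \<open>With t = d + 2n and x = d - 2n one has t^2 - x^2 = 8 n d, while 8 T + 1 is the square of
  2i + 1 for T = \<open>tri i\<close>; so N = T + n d becomes the equation of \<open>lat\<close>. On
  a term, D - 1 comes from differentiating \<open>W0\<close> and -T from differentiating psi, which
  is the left side of \<open>weight_convert\<close>.\<close>

lemma weighted_series_lattice:
  "fps_nth (psi * (qD W0 - W0) - qD psi * W0 + psi * X1) N =
   2 * (\<Sum>(y, t, x)\<in>{(y, t, x) \<in> lat (8 * int N + 1). 0 < x \<and> x < t}. latf y t x)"
proof -
  let ?I = "{i. tri i \<le> N}"
  let ?F = "\<lambda>m. {(n, d) \<in> facs m. odd d \<and> 2 * n < d}"
  let ?g = "\<lambda>i (n, d). latf (2 * int i + 1) (int d + 2 * int n) (int d - 2 * int n)"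
  have W0: "fps_nth W0 m = (\<Sum>(n, d)\<in>?F m. cubic_weight (of_nat (d - 2 * n)))" for m
    unfolding W0_def Lam_nth by (rule sum.mono_neutral_cong_right) (auto simp: finite_facs split: if_splits)
  have X1: "fps_nth X1 m = (\<Sum>(n, d)\<in>?F m. of_nat (d - 2 * n))" for m
    unfolding X1_def Lam_nth by (rule sum.mono_neutral_cong_right) (auto simp: finite_facs split: if_splits)
  have "fps_nth (psi * (qD W0 - W0) - qD psi * W0 + psi * X1) N =
     (\<Sum>i\<in>?I. (of_nat (N - tri i) - 1 - of_nat (tri i)) * fps_nth W0 (N - tri i) + fps_nth X1 (N - tri i))"
    by (simp add: psi_mult_nth qD_psi_mult_nth qD_nth left_diff_distrib sum.distrib sum_subtractf sum_distrib_left sum_negf mult.assoc)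
  also have "\<dots> = (\<Sum>i\<in>?I. \<Sum>p\<in>?F (N - tri i). 2 * ?g i p)"
  proof (rule sum.cong[OF refl])
    fix i assume i: "i \<in> ?I"
    have "(\<Sum>p\<in>?F (N - tri i). 2 * ?g i p) =
      (\<Sum>(n, d)\<in>?F (N - tri i). (of_nat (N - tri i) - 1 - of_nat (tri i)) * cubic_weight (of_nat (d - 2 * n)) + of_nat (d - 2 * n))"
    proof (rule sum.cong[OF refl], clarify)
      fix n d assume "(n, d) \<in> facs (N - tri i)" "odd d" "2 * n < d"
      then have D: "n * d = N - tri i" and x: "int d - 2 * int n = int (d - 2 * n)"
        by (auto simp: facs_def)
      have "(int d + 2 * int n)\<^sup>2 - (2 * int i + 1)\<^sup>2 = (int d - 2 * int n)\<^sup>2 + 8 * int (n * d) - 1 - 8 * int (tri i)"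
        by (simp flip: tri_int) (simp add: power2_eq_square algebra_simps)
      then have "latf (2 * int i + 1) (int d + 2 * int n) (int d - 2 * int n) =
          (of_nat (d - 2 * n) ^ 2 + 8 * of_nat (N - tri i) - 1 - 8 * of_nat (tri i)) * cubic_weight (of_nat (d - 2 * n))"
        unfolding latf_def x D by (simp del: of_nat_diff)
      then show "2 * latf (2 * int i + 1) (int d + 2 * int n) (int d - 2 * int n) =
        (of_nat (N - tri i) - 1 - of_nat (tri i)) * cubic_weight (of_nat (d - 2 * n)) + of_nat (d - 2 * n)"
        by (simp only: weight_convert)
    qed
    also have "\<dots> = (of_nat (N - tri i) - 1 - of_nat (tri i)) * fps_nth W0 (N - tri i) + fps_nth X1 (N - tri i)"
      unfolding W0 X1 by (simp add: sum.distrib sum_distrib_left case_prod_unfold)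
    finally show "(of_nat (N - tri i) - 1 - of_nat (tri i)) * fps_nth W0 (N - tri i) + fps_nth X1 (N - tri i) =
        (\<Sum>p\<in>?F (N - tri i). 2 * ?g i p)" ..
  qed
  also have "\<dots> = 2 * (\<Sum>(i, p)\<in>(SIGMA i:?I. ?F (N - tri i)). ?g i p)"
    by (subst sum.Sigma[symmetric]) (auto simp: finite_tri_le sum_distrib_left intro: finite_subset[OF _ finite_facs])
  also have "(\<Sum>(i, p)\<in>(SIGMA i:?I. ?F (N - tri i)). ?g i p) =
      (\<Sum>(y, t, x)\<in>{(y, t, x) \<in> lat (8 * int N + 1). 0 < x \<and> x < t}. latf y t x)"
  proof (rule sum.reindex_bij_witness[where
      j = "\<lambda>(i, n, d). (if 4 dvd 2 * int i + 1 - (int d - 2 * int n) then 2 * int i + 1 else - (2 * int i + 1),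
                        int d + 2 * int n, int d - 2 * int n)" and
      i = "\<lambda>(y, t, x). (nat ((\<bar>y\<bar> - 1) div 2), nat ((t - x) div 4), nat ((t + x) div 2))"])
    fix q assume "q \<in> (SIGMA i:?I. ?F (N - tri i))"
    then obtain i n d where q: "q = (i, n, d)" "tri i \<le> N" "0 < n" "0 < d" "n * d = N - tri i" "odd d" "2 * n < d"
      by (auto simp: facs_def)
    \<comment> \<open>Exactly one of the odd numbers 2i + 1 and -(2i + 1) is congruent to x modulo
      4. The absolute value recovers i.\<close>
    let ?y = "if 4 dvd 2 * int i + 1 - (int d - 2 * int n) then 2 * int i + 1 else - (2 * int i + 1)"
    have y2: "?y\<^sup>2 = (2 * int i + 1)\<^sup>2" by (simp add: power2_eq_square algebra_simps)
    have "4 dvd ?y - (int d - 2 * int n)"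
      using q(6) by (auto elim!: oddE) presburger
    moreover have "int (n * d) = int N - int (tri i)"
      using q(2,5) by (simp add: of_nat_diff)
    then have "?y\<^sup>2 + (int d + 2 * int n)\<^sup>2 - (int d - 2 * int n)\<^sup>2 = 8 * int N + 1"
      unfolding y2 tri_int[symmetric] by (simp add: power2_eq_square algebra_simps)
    ultimately show "(\<lambda>(i, n, d). (if 4 dvd 2 * int i + 1 - (int d - 2 * int n) then 2 * int i + 1 else - (2 * int i + 1),
                        int d + 2 * int n, int d - 2 * int n)) q \<in> {(y, t, x) \<in> lat (8 * int N + 1). 0 < x \<and> x < t}"
      using q by (auto simp: lat_def)
    show "(\<lambda>(y, t, x). (nat ((\<bar>y\<bar> - 1) div 2), nat ((t - x) div 4), nat ((t + x) div 2)))
       ((\<lambda>(i, n, d). (if 4 dvd 2 * int i + 1 - (int d - 2 * int n) then 2 * int i + 1 else - (2 * int i + 1),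
                        int d + 2 * int n, int d - 2 * int n)) q) = q"
      by (simp add: q(1))
    show "(\<lambda>(y, t, x). latf y t x) ((\<lambda>(i, n, d). (if 4 dvd 2 * int i + 1 - (int d - 2 * int n) then 2 * int i + 1 else - (2 * int i + 1),
                        int d + 2 * int n, int d - 2 * int n)) q) = (\<lambda>(i, p). ?g i p) q"
      unfolding q(1) prod.case latf_def y2 ..
  next
    fix q assume "q \<in> {(y, t, x) \<in> lat (8 * int N + 1). 0 < x \<and> x < t}"
    then obtain y t x where q: "q = (y, t, x)" "odd x" "4 dvd y - x" "4 dvd t - x"
      "y\<^sup>2 + t\<^sup>2 - x\<^sup>2 = 8 * int N + 1" "0 < x" "x < t"
      by (auto simp: lat_def)
    from q(2) obtain h where h: "x = 2 * h + 1" by (rule oddE)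
    from q(4) obtain n' where n': "t = x + 4 * n'" by (metis dvdE add_diff_cancel_left' diff_add_cancel add.commute)
    from q(3) obtain r where r: "y = x + 4 * r" by (metis dvdE add_diff_cancel_left' diff_add_cancel add.commute)
    define n where "n = nat n'"
    have n: "n' = int n" "0 < n" using q(7) n' by (auto simp: n_def)
    define d where "d = nat (x + 2 * n')"
    have d: "int d = x + 2 * int n" using q(6) n by (auto simp: d_def)
    define i where "i = nat ((\<bar>y\<bar> - 1) div 2)"
    have "odd \<bar>y\<bar>" unfolding r h by presburger
    then obtain k where "\<bar>y\<bar> = 2 * k + 1" by (rule oddE)
    moreover from this have "0 \<le> k" using abs_ge_zero[of y] by linarith
    ultimately have i: "\<bar>y\<bar> = 2 * int i + 1" by (simp add: i_def)
    have y2: "y\<^sup>2 = 8 * int (tri i) + 1"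
      unfolding tri_int i[symmetric] by simp
    have "8 * int (n * d) = t\<^sup>2 - x\<^sup>2"
      unfolding n' n by (simp add: d power2_eq_square algebra_simps)
    with y2 q(5) have N: "int (n * d) + int (tri i) = int N" by linarith
    have odd: "odd d" using d h by presburger
    have "2 * n < d" using d q(6) by linarith
    moreover have "tri i \<le> N" "n * d = N - tri i" using N by linarith+
    moreover have eq: "(\<lambda>(y, t, x). (nat ((\<bar>y\<bar> - 1) div 2), nat ((t - x) div 4), nat ((t + x) div 2))) q = (i, n, d)"
      using d n' n by (simp add: q(1) i_def)
    ultimately show "(\<lambda>(y, t, x). (nat ((\<bar>y\<bar> - 1) div 2), nat ((t - x) div 4), nat ((t + x) div 2))) q
        \<in> (SIGMA i:?I. ?F (N - tri i))"
      using odd n(2) by (auto simp: facs_def)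
    have "(if 4 dvd 2 * int i + 1 - x then 2 * int i + 1 else - (2 * int i + 1)) = y"
      using i r h by presburger
    then show "(\<lambda>(i, n, d). (if 4 dvd 2 * int i + 1 - (int d - 2 * int n) then 2 * int i + 1 else - (2 * int i + 1),
                        int d + 2 * int n, int d - 2 * int n))
      ((\<lambda>(y, t, x). (nat ((\<bar>y\<bar> - 1) div 2), nat ((t - x) div 4), nat ((t + x) div 2))) q) = q"
      unfolding eq using d n' n by (simp add: q(1))
  qed
  finally show ?thesis .
qed

text \<open>
  The coordinates $s = y + t - x$, $p = (t - x)/4$, $r = (x - y)/4$ turn
  $y^2 + t^2 - x^2$ into $s^2 + 32 p r$.
\<close>

definition lat_eval :: "int \<Rightarrow> nat \<Rightarrow> nat \<Rightarrow> 5" where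
  "lat_eval s p r = latf (s - 4 * int p) (s + 4 * int r) (s - 4 * int p + 4 * int r)"

lemma lattice_middle:
  "(\<Sum>(y, t, x)\<in>{(y, t, x) \<in> lat (8 * int N + 1). y < x \<and> x < t}. latf y t x) =
   (\<Sum>i\<in>{i. tri i \<le> N}. \<Sum>(p, r)\<in>prs (N - tri i).
       lat_eval (2 * int i + 1) p r + lat_eval (- (2 * int i + 1)) p r)"
proof -
  let ?I = "{i. tri i \<le> N}"
  \<comment> \<open>The boolean records the sign of s. The region y < x < t only says that p and r
    are positive, so s runs over all odd integers.\<close>
  let ?s = "\<lambda>i b. if b then 2 * int i + 1 else - (2 * int i + 1)"
  have "(\<Sum>i\<in>?I. \<Sum>(p, r)\<in>prs (N - tri i). lat_eval (2 * int i + 1) p r + lat_eval (- (2 * int i + 1)) p r) =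
        (\<Sum>i\<in>?I. \<Sum>q\<in>prs (N - tri i). \<Sum>b\<in>UNIV. lat_eval (?s i b) (fst q) (snd q))"
    by (simp add: UNIV_bool case_prod_unfold add.commute)
  also have "\<dots> = (\<Sum>(i, q, b)\<in>(SIGMA i:?I. SIGMA q:prs (N - tri i). UNIV). lat_eval (?s i b) (fst q) (snd q))"
    by (simp add: sum.Sigma finite_tri_le finite_prs case_prod_unfold)
  also have "\<dots> = (\<Sum>(y, t, x)\<in>{(y, t, x) \<in> lat (8 * int N + 1). y < x \<and> x < t}. latf y t x)"
  proof (rule sum.reindex_bij_witness[where
      j = "\<lambda>(i, (p, r), b). (?s i b - 4 * int p, ?s i b + 4 * int r, ?s i b - 4 * int p + 4 * int r)" and
      i = "\<lambda>(y, t, x). (nat ((\<bar>y + t - x\<bar> - 1) div 2), (nat ((t - x) div 4), nat ((x - y) div 4)), 0 < y + t - x)"])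
    fix q assume "q \<in> (SIGMA i:?I. SIGMA q:prs (N - tri i). (UNIV :: bool set))"
    then obtain i p r b where q: "q = (i, (p, r), b)" "tri i \<le> N" "0 < p" "0 < r" "4 * (p * r) = N - tri i"
      by (auto simp: prs_def)
    define s where "s = ?s i b"
    have s2: "s\<^sup>2 = (2 * int i + 1)\<^sup>2" by (simp add: s_def power2_eq_square algebra_simps)
    have "int (4 * (p * r)) = int N - int (tri i)"
      using q(2,5) by (simp add: of_nat_diff)
    then have "(s - 4 * int p)\<^sup>2 + (s + 4 * int r)\<^sup>2 - (s - 4 * int p + 4 * int r)\<^sup>2 = 8 * int N + 1"
      using s2 unfolding tri_int[symmetric] by (simp add: power2_eq_square algebra_simps)
    moreover have "odd (s - 4 * int p + 4 * int r)" by (simp add: s_def)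
    moreover have "s - 4 * int p - (s - 4 * int p + 4 * int r) = 4 * (- int r)"
      "s + 4 * int r - (s - 4 * int p + 4 * int r) = 4 * int p" by simp_all
    then have "4 dvd s - 4 * int p - (s - 4 * int p + 4 * int r)" "4 dvd s + 4 * int r - (s - 4 * int p + 4 * int r)"
      by (metis dvd_triv_left)+
    ultimately show "(\<lambda>(i, (p, r), b). (?s i b - 4 * int p, ?s i b + 4 * int r, ?s i b - 4 * int p + 4 * int r)) q
       \<in> {(y, t, x) \<in> lat (8 * int N + 1). y < x \<and> x < t}"
      using q(3,4) unfolding q(1) prod.case s_def[symmetric] by (simp add: lat_def)
    show "(\<lambda>(y, t, x). (nat ((\<bar>y + t - x\<bar> - 1) div 2), (nat ((t - x) div 4), nat ((x - y) div 4)), 0 < y + t - x))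
        ((\<lambda>(i, (p, r), b). (?s i b - 4 * int p, ?s i b + 4 * int r, ?s i b - 4 * int p + 4 * int r)) q) = q"
      by (simp add: q(1))
    show "(\<lambda>(y, t, x). latf y t x) ((\<lambda>(i, (p, r), b). (?s i b - 4 * int p, ?s i b + 4 * int r, ?s i b - 4 * int p + 4 * int r)) q)
        = (\<lambda>(i, q, b). lat_eval (?s i b) (fst q) (snd q)) q"
      by (simp add: q(1) lat_eval_def)
  next
    fix q assume "q \<in> {(y, t, x) \<in> lat (8 * int N + 1). y < x \<and> x < t}"
    then obtain y t x where q: "q = (y, t, x)" "odd x" "4 dvd y - x" "4 dvd t - x"
      "y\<^sup>2 + t\<^sup>2 - x\<^sup>2 = 8 * int N + 1" "y < x" "x < t"
      by (auto simp: lat_def)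
    from q(4) obtain p' where p': "t = x + 4 * p'" by (metis dvdE add_diff_cancel_left' diff_add_cancel add.commute)
    from q(3) obtain r' where r': "y = x + 4 * r'" by (metis dvdE add_diff_cancel_left' diff_add_cancel add.commute)
    define p where "p = nat p'"
    define r where "r = nat (- r')"
    have p: "p' = int p" "0 < p" using q(7) p' by (auto simp: p_def)
    have r: "r' = - int r" "0 < r" using q(6) r' by (auto simp: r_def)
    define s where "s = y + t - x"
    have x: "x = s - 4 * int p + 4 * int r" and y: "y = s - 4 * int p" and t: "t = s + 4 * int r"
      unfolding s_def p' r' p r by simp_all
    define i where "i = nat ((\<bar>s\<bar> - 1) div 2)"
    have "odd \<bar>s\<bar>" using q(2) unfolding x by simp
    then obtain k where "\<bar>s\<bar> = 2 * k + 1" by (rule oddE)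
    moreover from this have "0 \<le> k" using abs_ge_zero[of s] by linarith
    ultimately have i: "\<bar>s\<bar> = 2 * int i + 1" by (simp add: i_def)
    have s2: "s\<^sup>2 = 8 * int (tri i) + 1"
      unfolding tri_int i[symmetric] by simp
    have "8 * int (4 * (p * r)) + s\<^sup>2 = 8 * int N + 1"
      using q(5) unfolding x y t by (simp add: power2_eq_square algebra_simps)
    with s2 have N: "int (4 * (p * r)) + int (tri i) = int N" by linarith
    have "tri i \<le> N" "4 * (p * r) = N - tri i" using N by linarith+
    moreover have eq: "(\<lambda>(y, t, x). (nat ((\<bar>y + t - x\<bar> - 1) div 2), (nat ((t - x) div 4), nat ((x - y) div 4)), 0 < y + t - x)) q
        = (i, (p, r), 0 < s)"
      by (simp add: q(1) i_def x y t)
    ultimately show "(\<lambda>(y, t, x). (nat ((\<bar>y + t - x\<bar> - 1) div 2), (nat ((t - x) div 4), nat ((x - y) div 4)), 0 < y + t - x)) q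
        \<in> (SIGMA i:?I. SIGMA q:prs (N - tri i). UNIV)"
      using p(2) r(2) by (auto simp: prs_def)
    have "?s i (0 < s) = s" using i by auto
    then show "(\<lambda>(i, (p, r), b). (?s i b - 4 * int p, ?s i b + 4 * int r, ?s i b - 4 * int p + 4 * int r))
       ((\<lambda>(y, t, x). (nat ((\<bar>y + t - x\<bar> - 1) div 2), (nat ((t - x) div 4), nat ((x - y) div 4)), 0 < y + t - x)) q) = q"
      unfolding eq prod.case by (simp only:) (simp add: q(1) x y t)
  qed
  finally show ?thesis ..
qed

text \<open>Adding the terms for s and -s leaves only even powers of s, hence a polynomial in T =
  (s^2 - 1)/8, p and r. Modulo 5 it is symmetric in p and r and splits into this expression, with k
  = p r, plus its mirror image. Only p and p^3 stand beside T and k, so that summation gives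
  \<open>sig4\<close>, \<open>cub4\<close> and their derivatives.\<close>

definition half_weight :: "5 \<Rightarrow> 5 \<Rightarrow> 5 \<Rightarrow> 5" where
  "half_weight T p k = (T ^ 2 - 2) * p - (1 + T) * p ^ 3 + (1 + T) * k * p + 4 * k * p ^ 3 - k ^ 2 * p"

text \<open>The certificate for \<open>lat_eval_polynomial\<close>, valid in every commutative ring.
  The fifth powers are kept apart because x^5 = x holds for the elements of \<open>5\<close> but is
  not a consequence of 5 = 0.\<close>

lemma lat_eval_polynomial_ring:
  fixes s p r :: "'a::comm_ring_1"
  defines "x \<equiv> s - 4 * p + 4 * r" and "x' \<equiv> - s - 4 * p + 4 * r" and "T \<equiv> 2 * (s ^ 2 - 1)" and "k \<equiv> p * r"
  shows "((s + 4 * r) ^ 2 - (s - 4 * p) ^ 2) * (2 * x - x ^ 3) +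
     ((- s + 4 * r) ^ 2 - (- s - 4 * p) ^ 2) * (2 * x' - x' ^ 3) -
     ((T ^ 2 - 2) * p - (1 + T) * p ^ 3 + (1 + T) * k * p + 4 * k * p ^ 3 - k ^ 2 * p +
     ((T ^ 2 - 2) * r - (1 + T) * r ^ 3 + (1 + T) * k * r + 4 * k * r ^ 3 - k ^ 2 * r)) =
     5 * (- 410 * r + 51 * r ^ 3 - 410 * p - 51 * p * r ^ 2 + 1228 * p * r ^ 4 - 51 * p ^ 2 * r - 819 * p ^ 2 * r ^ 3
       + 51 * p ^ 3 - 819 * p ^ 3 * r ^ 2 + 1228 * p ^ 4 * r + 8 * s ^ 2 * r - 230 * s ^ 2 * r ^ 3 + 8 * s ^ 2 * p
       + 230 * s ^ 2 * p * r ^ 2 + 230 * s ^ 2 * p ^ 2 * r - 230 * s ^ 2 * p ^ 3 - 4 * s ^ 4 * r - 4 * s ^ 4 * p)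
     - 2048 * (p ^ 5 - p) - 2048 * (r ^ 5 - r)"
  unfolding x_def x'_def T_def k_def
  by (simp add: algebra_simps power2_eq_square power3_eq_cube power_numeral_reduce)

lemma lat_eval_polynomial:
  fixes s p r :: 5
  shows "((s + 4 * r) ^ 2 - (s - 4 * p) ^ 2) * cubic_weight (s - 4 * p + 4 * r) +
     ((- s + 4 * r) ^ 2 - (- s - 4 * p) ^ 2) * cubic_weight (- s - 4 * p + 4 * r) =
     half_weight (2 * (s ^ 2 - 1)) p (p * r) + half_weight (2 * (s ^ 2 - 1)) r (p * r)"
  unfolding cubic_weight_def half_weight_def
  by (rule eq_mod5[OF five], subst lat_eval_polynomial_ring, simp only: fermat_mod5 diff_self mult_zero_right diff_zero)

text \<open>The inverse of 8 modulo 5 is 2; this explains the form in which T = (s^2 - 1)/8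
  occurs.\<close>

lemma eighth_mod5:
  fixes a t :: "'a::comm_ring_1"
  assumes five: "(5::'a) = 0" and "8 * t + 1 = a"
  shows "2 * (a - 1) = t"
  by (rule eq_mod5[OF five, where c = "3 * t"]) (simp add: assms(2)[symmetric])

lemma odd_square_mod5: "2 * ((2 * of_nat i + 1) ^ 2 - 1) = (of_nat (tri i) :: 5)"
proof (rule eighth_mod5[OF five])
  have "(of_int (8 * int (tri i) + 1) :: 5) = of_int ((2 * int i + 1)\<^sup>2)"
    by (simp only: tri_int)
  then show "8 * of_nat (tri i) + 1 = (2 * of_nat i + (1::5)) ^ 2"
    by (simp only: of_int_add of_int_mult of_int_numeral of_int_of_nat_eq of_int_power of_int_1)
qed

lemma lattice_middle_weights:
  "(\<Sum>(y, t, x)\<in>{(y, t, x) \<in> lat (8 * int N + 1). y < x \<and> x < t}. latf y t x) =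
   2 * (\<Sum>i\<in>{i. tri i \<le> N}. \<Sum>(p, r)\<in>prs (N - tri i).
          half_weight (of_nat (tri i)) (of_nat p) (of_nat p * of_nat r))"
proof -
  have *: "lat_eval (2 * int i + 1) p r + lat_eval (- (2 * int i + 1)) p r =
     half_weight (of_nat (tri i)) (of_nat p) (of_nat p * of_nat r) +
     half_weight (of_nat (tri i)) (of_nat r) (of_nat p * of_nat r)" for i p r
    using lat_eval_polynomial[of "2 * of_nat i + 1" "of_nat r" "of_nat p"]
    unfolding odd_square_mod5 by (simp add: lat_eval_def latf_def)
  have swap: "(\<Sum>(p, r)\<in>prs n. half_weight T (of_nat r) (of_nat p * of_nat r)) =
      (\<Sum>(p, r)\<in>prs n. half_weight T (of_nat p) (of_nat p * of_nat r))" for n T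
    by (rule sum.reindex_bij_witness[where i = "\<lambda>(p, r). (r, p)" and j = "\<lambda>(p, r). (r, p)"])
       (auto simp: prs_def mult.commute)
  have "(\<Sum>(p, r)\<in>prs n. half_weight T (of_nat p) (of_nat p * of_nat r) + half_weight T (of_nat r) (of_nat p * of_nat r)) =
      2 * (\<Sum>(p, r)\<in>prs n. half_weight T (of_nat p) (of_nat p * of_nat r))" for n T
    using swap[of T n] by (simp only: case_prod_unfold sum.distrib mult_2)
  then show ?thesis
    unfolding lattice_middle * sum_distrib_left[of 2] by (simp only:)
qed

text \<open>A telescoping sum: \<open>A1\<close> and \<open>A3\<close> are antidifferences of z and
  z^3 modulo 5 for the step 4, and the summand is \<tau> (2z - z^3) - 2z^3 + z because z^5 = z.
  Their constants are such that both vanish at the starting points 1 and 3.\<close>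

lemma diagonal_sum:
  fixes \<tau> :: 5
  assumes "\<rho> = 1 \<or> \<rho> = 3"
  defines "A1 \<equiv> \<lambda>z::5. 2 * z ^ 2 + 2 * z + 1" and "A3 \<equiv> \<lambda>z::5. z ^ 4 + 2 * z ^ 3 + z ^ 2 + 1"
  shows "(\<Sum>k<m. (\<tau> - of_nat (4 * k + \<rho>) ^ 2) * cubic_weight (of_nat (4 * k + \<rho>))) =
    \<tau> * (2 * A1 (of_nat (4 * m + \<rho>)) - A3 (of_nat (4 * m + \<rho>))) - 2 * A3 (of_nat (4 * m + \<rho>)) + A1 (of_nat (4 * m + \<rho>))"
proof (induction m)
  case 0
  have "\<forall>\<tau>. \<tau> * (2 * A1 1 - A3 1) - 2 * A3 1 + A1 1 = 0" "\<forall>\<tau>. \<tau> * (2 * A1 3 - A3 3) - 2 * A3 3 + A1 3 = 0"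
    unfolding forall_mod5 A1_def A3_def by simp_all
  note base = this[rule_format]
  show ?case
    using assms(1)
  proof (elim disjE)
    assume \<rho>: "\<rho> = 1"
    show ?thesis unfolding \<rho> mult_0_right add_0 of_nat_1 base(1) lessThan_0 by (rule sum.empty)
  next
    assume \<rho>: "\<rho> = 3"
    show ?thesis unfolding \<rho> mult_0_right add_0 of_nat_numeral base(2) lessThan_0 by (rule sum.empty)
  qed
next
  case (Suc m)
  have step: "\<forall>z \<tau>. (\<tau> - z ^ 2) * cubic_weight z + (\<tau> * (2 * A1 z - A3 z) - 2 * A3 z + A1 z) =
      \<tau> * (2 * A1 (z + 4) - A3 (z + 4)) - 2 * A3 (z + 4) + A1 (z + 4)"
    unfolding forall_mod5 A1_def A3_def cubic_weight_def by simp
  have "4 * Suc m + \<rho> = (4 * m + \<rho>) + 4" by simp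
  then have z: "(of_nat (4 * Suc m + \<rho>) :: 5) = of_nat (4 * m + \<rho>) + 4"
    by (simp only: of_nat_add of_nat_numeral)
  show ?case
    unfolding z step[rule_format, symmetric] sum.lessThan_Suc Suc by (rule add.commute)
qed

text \<open>For y = x the equation becomes t^2 = 8N + 1, so N is triangular, and x runs over the
  numbers below t in its class modulo 4. The value is the N-th coefficient of D psi - D^2
  psi.\<close>

lemma lattice_diagonal:
  "(\<Sum>(y, t, x)\<in>{(y, t, x) \<in> lat (8 * int N + 1). 0 < x \<and> x < t \<and> y = x}. latf y t x) =
   (if N \<in> range tri then of_nat N - of_nat N ^ 2 else 0)"
proof (cases "N \<in> range tri")
  case True
  then obtain j where N: "N = tri j" by blast
  define t m \<rho> where "t = 2 * j + 1" and "m = t div 4" and "\<rho> = t mod 4"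
  have t: "t = 4 * m + \<rho>" by (simp add: m_def \<rho>_def)
  have \<rho>: "\<rho> = 1 \<or> \<rho> = 3" unfolding \<rho>_def t_def by presburger
  have M: "8 * int N + 1 = (int t)\<^sup>2" by (simp add: N tri_int t_def)
  have "(\<Sum>(y, t, x)\<in>{(y, t, x) \<in> lat (8 * int N + 1). 0 < x \<and> x < t \<and> y = x}. latf y t x) =
        (\<Sum>k<m. latf (int (4 * k + \<rho>)) (int t) (int (4 * k + \<rho>)))"
  proof (rule sum.reindex_bij_witness[where j = "\<lambda>(y, t, x). nat x div 4" and
        i = "\<lambda>k. (int (4 * k + \<rho>), int t, int (4 * k + \<rho>))"])
    fix q assume "q \<in> {(y, t, x) \<in> lat (8 * int N + 1). 0 < x \<and> x < t \<and> y = x}"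
    then obtain t' x where q: "q = (x, t', x)" "odd x" "4 dvd t' - x" "t'\<^sup>2 = (int t)\<^sup>2" "0 < x" "x < t'"
      unfolding M by (auto simp: lat_def)
    from q(4-6) have t': "t' = int t" by (simp add: power2_eq_iff)
    obtain x' where x': "x = int x'" using q(5) zero_less_imp_eq_int by blast
    have "int t mod 4 = int x' mod 4"
      using q(3) unfolding t' x' by (simp only: mod_eq_dvd_iff)
    then have "int (t mod 4) = int (x' mod 4)" by (simp only: zmod_int of_nat_numeral)
    then have "nat x mod 4 = \<rho>"
      unfolding x' \<rho>_def by simp
    then have x: "x = int (4 * (nat x div 4) + \<rho>)"
      using q(5) by (metis mult_div_mod_eq nat_0_le order_less_imp_le)
    show "(\<lambda>k. (int (4 * k + \<rho>), int t, int (4 * k + \<rho>))) ((\<lambda>(y, t, x). nat x div 4) q) = q"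
      unfolding q(1) prod.case x[symmetric] t' ..
    show "(\<lambda>(y, t, x). nat x div 4) q \<in> {..<m}"
      using q(6) x unfolding q(1) t' t by simp
    show "latf (int (4 * ((\<lambda>(y, t, x). nat x div 4) q) + \<rho>)) (int t) (int (4 * ((\<lambda>(y, t, x). nat x div 4) q) + \<rho>)) =
        (\<lambda>(y, t, x). latf y t x) q"
      unfolding q(1) prod.case x[symmetric] t' ..
  next
    fix k assume k: "k \<in> {..<m}"
    have \<rho>4: "\<rho> < 4" by (simp add: \<rho>_def)
    show "(\<lambda>(y, t, x). nat x div 4) (int (4 * k + \<rho>), int t, int (4 * k + \<rho>)) = k"
      using \<rho>4 by (simp add: nat_add_distrib nat_mult_distrib)
    have "odd (int (4 * k + \<rho>))" using \<rho> by auto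
    moreover have "int t - int (4 * k + \<rho>) = 4 * (int m - int k)" by (simp add: t)
    then have "4 dvd int t - int (4 * k + \<rho>)" by (metis dvd_triv_left)
    moreover have "0 < int (4 * k + \<rho>)" "int (4 * k + \<rho>) < int t" using \<rho> k t by auto
    ultimately show "(int (4 * k + \<rho>), int t, int (4 * k + \<rho>)) \<in> {(y, t, x) \<in> lat (8 * int N + 1). 0 < x \<and> x < t \<and> y = x}"
      unfolding M by (simp add: lat_def)
  qed
  also have "\<dots> = (\<Sum>k<m. (of_nat t ^ 2 - of_nat (4 * k + \<rho>) ^ 2) * cubic_weight (of_nat (4 * k + \<rho>)))"
    by (simp add: latf_def)
  also have "\<dots> = of_nat N - of_nat N ^ 2"
  proof -
    have *: "\<forall>z::5. z ^ 2 * (2 * (2 * z ^ 2 + 2 * z + 1) - (z ^ 4 + 2 * z ^ 3 + z ^ 2 + 1))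
        - 2 * (z ^ 4 + 2 * z ^ 3 + z ^ 2 + 1) + (2 * z ^ 2 + 2 * z + 1) =
        2 * (z ^ 2 - 1) - (2 * (z ^ 2 - 1)) ^ 2"
      unfolding forall_mod5 by simp
    have t2: "2 * (of_nat t ^ 2 - 1) = (of_nat N :: 5)"
      unfolding t_def N odd_square_mod5[symmetric] by (simp only: of_nat_add of_nat_mult of_nat_numeral of_nat_1)
    show ?thesis
      unfolding diagonal_sum[OF \<rho>] t[symmetric] *[rule_format] unfolding t2 ..
  qed
  finally show ?thesis using True by simp
next
  case False
  have "{(y, t, x) \<in> lat (8 * int N + 1). 0 < x \<and> x < t \<and> y = x} = {}"
  proof (rule ccontr)
    assume "{(y, t, x) \<in> lat (8 * int N + 1). 0 < x \<and> x < t \<and> y = x} \<noteq> {}"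
    then obtain t x where "(x, t, x) \<in> lat (8 * int N + 1)" "0 < x" "x < t" by blast
    then have t: "0 < t" "t\<^sup>2 = 8 * int N + 1" by (auto simp: lat_def)
    then have "odd (t\<^sup>2)" by simp
    then have "odd t" by simp
    then obtain k where k: "t = 2 * k + 1" by (rule oddE)
    with t have "t = 2 * int (nat k) + 1" by simp
    then have "8 * int (tri (nat k)) + 1 = 8 * int N + 1" using t(2) tri_int[of "nat k"] by simp
    then have "N = tri (nat k)" by simp
    with False show False by blast
  qed
  then show ?thesis using False by (simp only: sum.empty if_False)
qed

lemma half_weight_expand:
  fixes T p r :: "'a::comm_ring_1"
  assumes five: "(5::'a) = 0"
  shows "(4 * (p * r) - 1 - T) * p ^ 3 + (T ^ 2 - 2 - (1 + T) * (4 * (p * r)) - (4 * (p * r)) ^ 2) * p =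
    (T ^ 2 - 2) * p - (1 + T) * p ^ 3 + (1 + T) * (p * r) * p + 4 * (p * r) * p ^ 3 - (p * r) ^ 2 * p"
  by (rule eq_mod5[OF five, where c = "- (1 + T) * (p * r) * p - 3 * (p * r) ^ 2 * p"])
     (simp add: algebra_simps power2_eq_square power3_eq_cube)

lemma weight_regroup:
  fixes D T c s :: "'a::comm_ring_1"
  shows "D * c - c - 2 * s - D * s - D * (D * s) + T * (- c - D * s) + T ^ 2 * s =
    (D - 1 - T) * c + (T ^ 2 - 2 - (1 + T) * D - D ^ 2) * s"
  by (simp add: algebra_simps power2_eq_square)

text \<open>In the middle region the exponent left after removing T is D = 4 p r, so powers of p r
  become derivatives of \<open>sig4\<close> and \<open>cub4\<close>, and powers of T become
  derivatives of psi. The isolated \<open>qD psi\<close> and the -1 beside \<open>sig4\<close> are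
  the contribution of the diagonal.\<close>

lemma weighted_series_identity:
  "psi * (qD W0 - W0) - qD psi * W0 + psi * X1 =
     2 * (psi * (qD cub4 - cub4) - qD psi * cub4 + qD (qD psi) * (sig4 - 1) + qD psi - 2 * (psi * sig4)
          - (psi + qD psi) * qD sig4 - psi * qD (qD sig4))"
proof (rule fps_ext)
  fix N
  let ?I = "{i. tri i \<le> N}"
  have "fps_nth (2 * (psi * (qD cub4 - cub4) - qD psi * cub4 + qD (qD psi) * (sig4 - 1) + qD psi - 2 * (psi * sig4)
          - (psi + qD psi) * qD sig4 - psi * qD (qD sig4))) N =
     2 * ((\<Sum>i\<in>?I. \<Sum>(p, r)\<in>prs (N - tri i). half_weight (of_nat (tri i)) (of_nat p) (of_nat p * of_nat r))
        + fps_nth (qD psi - qD (qD psi)) N)"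
  proof -
    have hw: "(\<Sum>(p, r)\<in>prs D. half_weight T (of_nat p) (of_nat p * of_nat r)) =
        (of_nat D - 1 - T) * fps_nth cub4 D + (T ^ 2 - 2 - (1 + T) * of_nat D - of_nat D ^ 2) * fps_nth sig4 D" for D T
    proof -
      have "(of_nat D - 1 - T) * fps_nth cub4 D + (T ^ 2 - 2 - (1 + T) * of_nat D - of_nat D ^ 2) * fps_nth sig4 D =
        (\<Sum>(p, r)\<in>prs D. (of_nat D - 1 - T) * of_nat p ^ 3 + (T ^ 2 - 2 - (1 + T) * of_nat D - of_nat D ^ 2) * of_nat p)"
        unfolding cub4_def sig4_eq dilate4_nth by (simp add: sum.distrib sum_distrib_left case_prod_unfold)
      also have "\<dots> = (\<Sum>(p, r)\<in>prs D. half_weight T (of_nat p) (of_nat p * of_nat r))"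
      proof (rule sum.cong[OF refl], clarify)
        fix p r assume "(p, r) \<in> prs D"
        then have "(of_nat D :: 5) = of_nat (4 * (p * r))" by (simp add: prs_def)
        then have D: "(of_nat D :: 5) = 4 * (of_nat p * of_nat r)" by simp
        show "(of_nat D - 1 - T) * of_nat p ^ 3 + (T ^ 2 - 2 - (1 + T) * of_nat D - of_nat D ^ 2) * of_nat p =
          half_weight T (of_nat p) (of_nat p * of_nat r)"
          unfolding D half_weight_def by (rule half_weight_expand[OF five])
      qed
      finally show ?thesis ..
    qed
    let ?A = "qD cub4 - cub4 - 2 * sig4 - qD sig4 - qD (qD sig4)" and ?B = "- cub4 - qD sig4"
    have "psi * (qD cub4 - cub4) - qD psi * cub4 + qD (qD psi) * (sig4 - 1) + qD psi - 2 * (psi * sig4)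
          - (psi + qD psi) * qD sig4 - psi * qD (qD sig4) =
        psi * ?A + qD psi * ?B + qD (qD psi) * sig4 + (qD psi - qD (qD psi))"
      by (simp add: algebra_simps)
    moreover have "fps_nth (psi * ?A) N + fps_nth (qD psi * ?B) N + fps_nth (qD (qD psi) * sig4) N =
        (\<Sum>i\<in>?I. fps_nth ?A (N - tri i) + of_nat (tri i) * fps_nth ?B (N - tri i)
                 + of_nat (tri i) ^ 2 * fps_nth sig4 (N - tri i))"
      by (simp only: psi_mult_nth qD_psi_mult_nth qD2_psi_mult_nth sum.distrib)
    moreover have "\<dots> = (\<Sum>i\<in>?I. \<Sum>(p, r)\<in>prs (N - tri i). half_weight (of_nat (tri i)) (of_nat p) (of_nat p * of_nat r))"
      unfolding hw
      by (rule sum.cong[OF refl])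
         (simp only: fps_add_nth fps_sub_nth fps_neg_nth qD_nth numeral_mult_nth weight_regroup)
    ultimately show ?thesis
      by (simp only: numeral_mult_nth fps_add_nth)
  qed
  also have "fps_nth (qD psi - qD (qD psi)) N = (if N \<in> range tri then of_nat N - of_nat N ^ 2 else (0::5))"
    by (simp add: qD_nth psi_nth power2_eq_square)
  finally show "fps_nth (psi * (qD W0 - W0) - qD psi * W0 + psi * X1) N =
    fps_nth (2 * (psi * (qD cub4 - cub4) - qD psi * cub4 + qD (qD psi) * (sig4 - 1) + qD psi - 2 * (psi * sig4)
          - (psi + qD psi) * qD sig4 - psi * qD (qD sig4))) N"
    unfolding weighted_series_lattice lattice_sum lattice_middle_weights lattice_diagonal
    by (simp only: distrib_left)
qed

subsection \<open>Partitions in a box\<close>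

definition nro_partitions :: "nat \<Rightarrow> nat list set" where
  "nro_partitions N = {xs. is_partition xs N \<and> no_repeated_odd xs}"

text \<open>The number of columns of the 2-modular diagram, the c(\<lambda>) of the overview; the
  rows are the parts.\<close>

definition cols :: "nat list \<Rightarrow> nat" where
  "cols xs = (largest_part xs + 1) div 2"

text \<open>
  The sign makes the generating function of all partitions without repeated odd parts equal to $1 / \psi$
  rather than $1 / \psi(-q)$.
\<close>

definition pgf :: "(nat list \<Rightarrow> bool) \<Rightarrow> 'a::comm_ring_1 fps" where
  "pgf P = Abs_fps (\<lambda>N. (- 1) ^ N * of_nat (card {xs \<in> nro_partitions N. P xs}))"

lemma finite_nro_partitions: "finite (nro_partitions N)"
  unfolding nro_partitions_def by (rule finite_subset[OF _ finite_partitions[of N]]) auto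

lemma pgf_nth: "fps_nth (pgf P) N = (- 1) ^ N * of_nat (card {xs \<in> nro_partitions N. P xs})"
  by (simp add: pgf_def)

lemma pgf_cong:
  assumes "\<And>N xs. xs \<in> nro_partitions N \<Longrightarrow> P xs \<longleftrightarrow> Q xs"
  shows "pgf P = pgf Q"
proof (rule fps_ext)
  fix N
  have "{xs \<in> nro_partitions N. P xs} = {xs \<in> nro_partitions N. Q xs}" using assms by blast
  then show "fps_nth (pgf P) N = fps_nth (pgf Q) N" by (simp add: pgf_nth)
qed

lemma pgf_disjoint:
  assumes "\<And>N xs. xs \<in> nro_partitions N \<Longrightarrow> R xs \<longleftrightarrow> P xs \<or> Q xs"
    "\<And>N xs. xs \<in> nro_partitions N \<Longrightarrow> \<not> (P xs \<and> Q xs)"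
  shows "pgf R = pgf P + pgf Q"
proof (rule fps_ext)
  fix N
  have "{xs \<in> nro_partitions N. R xs} = {xs \<in> nro_partitions N. P xs} \<union> {xs \<in> nro_partitions N. Q xs}"
    using assms(1) by blast
  moreover have "card ({xs \<in> nro_partitions N. P xs} \<union> {xs \<in> nro_partitions N. Q xs}) =
      card {xs \<in> nro_partitions N. P xs} + card {xs \<in> nro_partitions N. Q xs}"
    using assms(2) by (intro card_Un_disjoint) (auto simp: finite_nro_partitions)
  ultimately show "fps_nth (pgf R) N = fps_nth (pgf P + pgf Q) N"
    by (simp add: pgf_nth distrib_left)
qed

lemma pgf_nth_sum:
  fixes f :: "nat list \<Rightarrow> nat"
  assumes "\<And>xs. xs \<in> nro_partitions N \<Longrightarrow> P xs \<Longrightarrow> f xs < L"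
  shows "fps_nth (pgf P) N = (\<Sum>n<L. fps_nth (pgf (\<lambda>xs. P xs \<and> f xs = n)) N)"
proof -
  have "{xs \<in> nro_partitions N. P xs} = (\<Union>n<L. {xs \<in> nro_partitions N. P xs \<and> f xs = n})"
    using assms by blast
  moreover have "card (\<Union>n<L. {xs \<in> nro_partitions N. P xs \<and> f xs = n}) =
      (\<Sum>n<L. card {xs \<in> nro_partitions N. P xs \<and> f xs = n})"
    by (rule card_UN_disjoint) (auto simp: finite_nro_partitions)
  ultimately show ?thesis
    by (simp add: pgf_nth sum_distrib_left)
qed

lemma largest_part_le_iff: "largest_part xs \<le> m \<longleftrightarrow> (\<forall>y\<in>set xs. y \<le> m)"
  by (simp add: largest_part_def)

lemma cols_le_iff: "cols xs \<le> k \<longleftrightarrow> (\<forall>y\<in>set xs. y \<le> 2 * k)"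
proof -
  have "cols xs \<le> k \<longleftrightarrow> largest_part xs \<le> 2 * k" unfolding cols_def by presburger
  then show ?thesis by (simp add: largest_part_le_iff)
qed

lemma Nil_nro_partitions: "[] \<in> nro_partitions N \<longleftrightarrow> N = 0"
  by (auto simp: nro_partitions_def is_partition_def no_repeated_odd_def)

lemma Cons_nro_partitions:
  "x # xs \<in> nro_partitions N \<longleftrightarrow>
     0 < x \<and> x \<le> N \<and> xs \<in> nro_partitions (N - x) \<and> (\<forall>y\<in>set xs. y \<le> x) \<and> (odd x \<longrightarrow> x \<notin> set xs)"
proof -
  have "no_repeated_odd (x # xs) \<longleftrightarrow> no_repeated_odd xs \<and> (odd x \<longrightarrow> x \<notin> set xs)"
  proof
    assume *: "no_repeated_odd (x # xs)"
    have "count_list xs j \<le> count_list (x # xs) j" for j by simp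
    then have "no_repeated_odd xs"
      using * unfolding no_repeated_odd_def by (meson order_trans)
    moreover have "x \<notin> set xs" if "odd x"
    proof -
      have "count_list (x # xs) x \<le> 1" using * that unfolding no_repeated_odd_def by blast
      then show ?thesis by (simp add: count_list_0_iff)
    qed
    ultimately show "no_repeated_odd xs \<and> (odd x \<longrightarrow> x \<notin> set xs)" by blast
  next
    assume *: "no_repeated_odd xs \<and> (odd x \<longrightarrow> x \<notin> set xs)"
    show "no_repeated_odd (x # xs)"
      unfolding no_repeated_odd_def
    proof (intro allI impI)
      fix j :: nat assume "odd j"
      with * show "count_list (x # xs) j \<le> 1"
        by (cases "x = j") (simp_all add: no_repeated_odd_def count_list_0_iff)
    qed
  qed
  moreover have "is_partition (x # xs) N \<longleftrightarrow> 0 < x \<and> x \<le> N \<and> is_partition xs (N - x) \<and> (\<forall>y\<in>set xs. y \<le> x)"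
    unfolding is_partition_def by auto
  ultimately show ?thesis
    unfolding nro_partitions_def by blast
qed

lemma cols_eq_0_iff: "xs \<in> nro_partitions N \<Longrightarrow> cols xs = 0 \<longleftrightarrow> xs = []"
  using cols_le_iff[of xs 0] by (cases xs) (auto simp: Cons_nro_partitions cols_def largest_part_def)

lemma cols_le: "xs \<in> nro_partitions N \<Longrightarrow> cols xs \<le> N"
  using member_le_sum_list[of _ xs] by (force simp: cols_le_iff nro_partitions_def is_partition_def)

lemma length_le: "xs \<in> nro_partitions N \<Longrightarrow> length xs \<le> N"
proof -
  have "length xs \<le> sum_list xs" if "\<forall>x \<in> set xs. 0 < x" for xs :: "nat list"
    using that by (induction xs) auto
  then show "xs \<in> nro_partitions N \<Longrightarrow> length xs \<le> N"
    by (auto simp: nro_partitions_def is_partition_def)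
qed

section \<open>Recurrences for boxes and the symmetry of columns and rows\<close>

definition boxgf :: "nat \<Rightarrow> nat \<Rightarrow> 'a::comm_ring_1 fps" where
  "boxgf k j = pgf (\<lambda>xs. cols xs \<le> k \<and> length xs \<le> j)"

lemma pgf_Nil: "pgf (\<lambda>xs. xs = []) = 1"
proof (rule fps_ext)
  fix N
  have "{xs \<in> nro_partitions N. xs = []} = (if N = 0 then {[]} else {})"
    by (auto simp: Nil_nro_partitions)
  then show "fps_nth (pgf (\<lambda>xs. xs = [])) N = fps_nth 1 N" by (simp add: pgf_nth)
qed

lemma boxgf_0_left: "boxgf 0 j = 1"
  unfolding boxgf_def pgf_Nil[symmetric] by (rule pgf_cong) (auto simp: cols_eq_0_iff)

lemma boxgf_0_right: "boxgf k 0 = 1"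
  unfolding boxgf_def pgf_Nil[symmetric] by (rule pgf_cong) (auto simp: cols_def largest_part_def)

lemma X_power_pgf_nth:
  "fps_nth (fps_X ^ p * pgf P :: 'a::comm_ring_1 fps) N =
     (- 1) ^ (N + p) * of_nat (card {xs. p \<le> N \<and> xs \<in> nro_partitions (N - p) \<and> P xs})"
proof (cases "p \<le> N")
  case True
  have "(- 1) ^ (N + p) = ((- 1) ^ ((N - p) + 2 * p) :: 'a)"
    using True by (intro arg_cong[of _ _ "power (- 1)"]) simp
  also have "\<dots> = (- 1) ^ (N - p)"
    unfolding power_add power_mult by simp
  finally have "(- 1) ^ (N - p) = ((- 1) ^ (N + p) :: 'a)" ..
  moreover have "fps_nth (fps_X ^ p * pgf P :: 'a fps) N = (- 1) ^ (N - p) * of_nat (card {xs \<in> nro_partitions (N - p). P xs})"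
    using True by (simp add: fps_X_power_mult_nth pgf_nth not_less)
  moreover have "{xs \<in> nro_partitions (N - p). P xs} = {xs. p \<le> N \<and> xs \<in> nro_partitions (N - p) \<and> P xs}"
    using True by simp
  ultimately show ?thesis by (simp only:)
qed (simp add: fps_X_power_mult_nth)

text \<open>The largest part is at most 2k, or 2k + 2, or 2k + 1. Below a part 2k + 1 the box
  shrinks to k columns, because an odd part is not repeated; its odd size causes the minus
  sign.\<close>

lemma boxgf_rec1:
  "boxgf (Suc k) (Suc j) = boxgf k (Suc j) + fps_X ^ (2 * k + 2) * boxgf (Suc k) j
      - fps_X ^ (2 * k + 1) * boxgf k j"
proof (rule fps_ext)
  fix N
  let ?A = "{xs \<in> nro_partitions N. cols xs \<le> k \<and> length xs \<le> Suc j}"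
  let ?B = "{xs. 2 * k + 2 \<le> N \<and> xs \<in> nro_partitions (N - (2 * k + 2)) \<and> cols xs \<le> Suc k \<and> length xs \<le> j}"
  let ?C = "{xs. 2 * k + 1 \<le> N \<and> xs \<in> nro_partitions (N - (2 * k + 1)) \<and> cols xs \<le> k \<and> length xs \<le> j}"
  have "{xs \<in> nro_partitions N. cols xs \<le> Suc k \<and> length xs \<le> Suc j} =
      ?A \<union> ((#) (2 * k + 2) ` ?B \<union> (#) (2 * k + 1) ` ?C)" (is "?L = ?R")
  proof (rule set_eqI)
    fix zs
    show "zs \<in> ?L \<longleftrightarrow> zs \<in> ?R"
    proof (cases zs)
      case Nil
      then show ?thesis by (auto simp: Nil_nro_partitions cols_le_iff)
    next
      case (Cons x xs)
      show ?thesis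
      proof
        assume "zs \<in> ?L"
        then have z: "0 < x" "x \<le> N" "xs \<in> nro_partitions (N - x)" "\<forall>y\<in>set xs. y \<le> x" "odd x \<longrightarrow> x \<notin> set xs"
          "x \<le> 2 * Suc k" "length xs \<le> j"
          by (auto simp: Cons Cons_nro_partitions cols_le_iff)
        consider "x \<le> 2 * k" | "x = 2 * k + 2" | "x = 2 * k + 1" using z(6) by force
        then show "zs \<in> ?R"
        proof cases
          case 1
          then have "zs \<in> ?A" using z by (auto simp: Cons Cons_nro_partitions cols_le_iff)
          then show ?thesis by blast
        next
          case 2
          then have "xs \<in> ?B" using z by (auto simp: cols_le_iff)
          then show ?thesis using 2 Cons by blast
        next
          case 3
          have "\<forall>y\<in>set xs. y \<le> 2 * k"
          proof
            fix y assume "y \<in> set xs"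
            then have "y \<le> 2 * k + 1" "y \<noteq> 2 * k + 1" using z 3 by auto
            then show "y \<le> 2 * k" by linarith
          qed
          then have "xs \<in> ?C" using z 3 by (auto simp: cols_le_iff)
          then show ?thesis using 3 Cons by blast
        qed
      next
        assume "zs \<in> ?R"
        then show "zs \<in> ?L"
          by (fastforce simp: Cons_nro_partitions cols_le_iff)
      qed
    qed
  qed
  then have "card {xs \<in> nro_partitions N. cols xs \<le> Suc k \<and> length xs \<le> Suc j} =
      card (?A \<union> ((#) (2 * k + 2) ` ?B \<union> (#) (2 * k + 1) ` ?C))" by simp
  also have "\<dots> = card ?A + (card ((#) (2 * k + 2) ` ?B) + card ((#) (2 * k + 1) ` ?C))"
  proof -
    have f: "finite ?A" "finite ?B" "finite ?C"
      by (auto intro: finite_subset[OF _ finite_nro_partitions])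
    have "?A \<inter> ((#) (2 * k + 2) ` ?B \<union> (#) (2 * k + 1) ` ?C) = {}"
      by (auto simp: cols_le_iff)
    moreover have "(#) (2 * k + 2) ` ?B \<inter> (#) (2 * k + 1) ` ?C = {}" by auto
    ultimately show ?thesis
      using f by (simp add: card_Un_disjoint)
  qed
  also have "\<dots> = card ?A + (card ?B + card ?C)"
    by (simp add: card_image)
  finally have "of_nat (card {xs \<in> nro_partitions N. cols xs \<le> Suc k \<and> length xs \<le> Suc j}) =
      (of_nat (card ?A) + (of_nat (card ?B) + of_nat (card ?C)) :: 'a)"
    by (simp only: of_nat_add)
  then show "fps_nth (boxgf (Suc k) (Suc j)) N = fps_nth (boxgf k (Suc j) + fps_X ^ (2 * k + 2) * boxgf (Suc k) j
      - fps_X ^ (2 * k + 1) * boxgf k j :: 'a fps) N"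
    unfolding boxgf_def fps_add_nth fps_sub_nth X_power_pgf_nth pgf_nth
    by (simp add: distrib_left power_add power_mult)
qed

lemma rec2_step_boundary:
  fixes x :: "'a::comm_ring_1"
  assumes "b = 1 + x ^ 2 * a - x" "b = a + x * q - q"
  shows "b + x ^ 3 * q - x ^ 2 * q = 1 + x ^ 2 * b - x"
proof -
  have "1 + x ^ 2 * b - x = 1 + x ^ 2 * (a + x * q - q) - x" by (simp only: assms(2))
  also have "\<dots> = (1 + x ^ 2 * a - x) + x ^ 3 * q - x ^ 2 * q"
    by (simp add: algebra_simps power2_eq_square power3_eq_cube)
  finally show ?thesis by (simp only: assms(1))
qed

text \<open>The indices of h are offsets of k and j, and p and q are the powers of x with exponents
  2k + 1 and 2j + 1. Assumptions c are instances of the recurrence to be proved, r are instances of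
  \<open>boxgf_rec1\<close>: expand by r, substitute c, regroup, and contract by r.\<close>

lemma rec2_step:
  fixes x p q :: "'a::comm_ring_1"
  assumes c: "h12 = h11 + x ^ 3 * q * h02 - x ^ 2 * q * h01" "h21 = h20 + x * q * h11 - q * h10"
      "h11 = h10 + x * q * h01 - q * h00"
    and r: "h22 = h12 + x ^ 3 * p * h21 - x ^ 2 * p * h11" "h21 = h11 + x ^ 3 * p * h20 - x ^ 2 * p * h10"
      "h12 = h02 + x * p * h11 - p * h01" "h11 = h01 + x * p * h10 - p * h00"
  shows "h22 = h21 + x ^ 3 * q * h12 - x ^ 2 * q * h11"
proof -
  have "h22 = (h11 + x ^ 3 * q * h02 - x ^ 2 * q * h01) + x ^ 3 * p * (h20 + x * q * h11 - q * h10)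
      - x ^ 2 * p * (h10 + x * q * h01 - q * h00)"
    by (simp only: r(1) c[symmetric])
  also have "\<dots> = (h11 + x ^ 3 * p * h20 - x ^ 2 * p * h10) + x ^ 3 * q * (h02 + x * p * h11 - p * h01)
      - x ^ 2 * q * (h01 + x * p * h10 - p * h00)"
    by (simp add: algebra_simps power2_eq_square power3_eq_cube)
  also have "\<dots> = h21 + x ^ 3 * q * h12 - x ^ 2 * q * h11"
    by (simp only: r(2-4)[symmetric])
  finally show ?thesis .
qed

lemma X_power_shift:
  "fps_X ^ (2 * k + 2) = fps_X * (fps_X ^ (2 * k + 1) :: 'a::comm_ring_1 fps)"
  "fps_X ^ (2 * Suc k + 2) = fps_X ^ 3 * (fps_X ^ (2 * k + 1) :: 'a::comm_ring_1 fps)"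
  "fps_X ^ (2 * Suc k + 1) = fps_X ^ 2 * (fps_X ^ (2 * k + 1) :: 'a::comm_ring_1 fps)"
  by (simp_all flip: power_add power_Suc)

text \<open>The mirror image of \<open>boxgf_rec1\<close>. Combinatorially it reflects conjugation
  of the 2-modular diagram; here it follows from the first recurrence by induction on k + j, without
  any bijection.\<close>

lemma boxgf_rec2:
  "boxgf (Suc k) (Suc j) = boxgf (Suc k) j + fps_X ^ (2 * j + 2) * boxgf k (Suc j)
      - fps_X ^ (2 * j + 1) * (boxgf k j :: 'a::comm_ring_1 fps)"
proof (induction "k + j" arbitrary: k j rule: less_induct)
  case less
  consider "k = 0" "j = 0" | j' where "k = 0" "j = Suc j'" | k' where "k = Suc k'" "j = 0"
    | k' j' where "k = Suc k'" "j = Suc j'"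
    by (metis not0_implies_Suc)
  then show ?case
  proof cases
    case 1
    then show ?thesis by (simp add: boxgf_rec1 boxgf_0_left boxgf_0_right)
  next
    case 2
    let ?b = "boxgf (Suc 0) (Suc j') :: 'a fps"
    have "?b = 1 + fps_X ^ 2 * boxgf (Suc 0) j' - fps_X"
      by (simp add: boxgf_rec1[of 0 j'] boxgf_0_left power2_eq_square)
    moreover have "?b = boxgf (Suc 0) j' + fps_X * fps_X ^ (2 * j' + 1) - fps_X ^ (2 * j' + 1)"
      using less[of 0 j'] 2 by (simp add: boxgf_0_left)
    ultimately have "?b + fps_X ^ 3 * fps_X ^ (2 * j' + 1) - fps_X ^ 2 * fps_X ^ (2 * j' + 1) =
        1 + fps_X ^ 2 * ?b - fps_X"
      by (rule rec2_step_boundary)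
    then show ?thesis
      unfolding 2 X_power_shift(2,3) by (simp add: boxgf_rec1[of 0 "Suc j'"] boxgf_0_left power2_eq_square)
  next
    case 3
    let ?b = "boxgf (Suc k') (Suc 0) :: 'a fps"
    have "?b = 1 + fps_X ^ 2 * boxgf k' (Suc 0) - fps_X"
      using less[of k' 0] 3 by (simp add: boxgf_0_right power2_eq_square)
    moreover have "?b = boxgf k' (Suc 0) + fps_X * fps_X ^ (2 * k' + 1) - fps_X ^ (2 * k' + 1)"
      by (simp add: boxgf_rec1[of k' 0] boxgf_0_right)
    ultimately have "?b + fps_X ^ 3 * fps_X ^ (2 * k' + 1) - fps_X ^ 2 * fps_X ^ (2 * k' + 1) =
        1 + fps_X ^ 2 * ?b - fps_X"
      by (rule rec2_step_boundary)
    then show ?thesis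
      unfolding 3 boxgf_rec1[of "Suc k'" 0] X_power_shift(2,3) by (simp add: boxgf_0_right power2_eq_square)
  next
    case 4
    show ?thesis
      unfolding 4 X_power_shift(2,3)
    proof (rule rec2_step)
      show "boxgf (Suc k') (Suc (Suc j')) = boxgf (Suc k') (Suc j') + fps_X ^ 3 * fps_X ^ (2 * j' + 1) * boxgf k' (Suc (Suc j'))
        - fps_X ^ 2 * fps_X ^ (2 * j' + 1) * (boxgf k' (Suc j') :: 'a fps)"
        using less[of k' "Suc j'"] 4 unfolding X_power_shift(2,3) by simp
      show "boxgf (Suc (Suc k')) (Suc j') = boxgf (Suc (Suc k')) j' + fps_X * fps_X ^ (2 * j' + 1) * boxgf (Suc k') (Suc j')
        - fps_X ^ (2 * j' + 1) * (boxgf (Suc k') j' :: 'a fps)"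
        using less[of "Suc k'" j'] 4 unfolding X_power_shift(1) by simp
      show "boxgf (Suc k') (Suc j') = boxgf (Suc k') j' + fps_X * fps_X ^ (2 * j' + 1) * boxgf k' (Suc j')
        - fps_X ^ (2 * j' + 1) * (boxgf k' j' :: 'a fps)"
        using less[of k' j'] 4 unfolding X_power_shift(1) by simp
    qed (rule boxgf_rec1[of "Suc k'" "Suc j'", unfolded X_power_shift(2,3)]
          boxgf_rec1[of "Suc k'" j', unfolded X_power_shift(2,3)]
          boxgf_rec1[of k' "Suc j'", unfolded X_power_shift(1)] boxgf_rec1[of k' j', unfolded X_power_shift(1)])+
  qed
qed

lemma boxgf_commute: "boxgf k j = boxgf j k"
proof (induction "k + j" arbitrary: k j rule: less_induct)
  case less
  show ?case
  proof (cases k; cases j)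
    fix k' j' assume [simp]: "k = Suc k'" "j = Suc j'"
    have "boxgf k' (Suc j') = (boxgf (Suc j') k' :: 'a fps)" "boxgf (Suc k') j' = (boxgf j' (Suc k') :: 'a fps)"
      "boxgf k' j' = (boxgf j' k' :: 'a fps)"
      by (rule less; simp)+
    then show ?thesis
      unfolding \<open>k = Suc k'\<close> \<open>j = Suc j'\<close> by (subst boxgf_rec1, subst boxgf_rec2) simp
  qed (simp_all add: boxgf_0_left boxgf_0_right)
qed

lemma card_box_commute:
  "card {xs \<in> nro_partitions N. cols xs \<le> k \<and> length xs \<le> j} =
   card {xs \<in> nro_partitions N. cols xs \<le> j \<and> length xs \<le> k}"
proof -
  have "fps_nth (boxgf k j :: int fps) N = fps_nth (boxgf j k) N"
    by (subst boxgf_commute) (rule refl)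
  then show ?thesis by (simp add: boxgf_def pgf_nth)
qed

lemma card_exact_commute:
  "card {xs \<in> nro_partitions N. cols xs = k \<and> length xs = j} =
   card {xs \<in> nro_partitions N. cols xs = j \<and> length xs = k}"
proof -
  \<comment> \<open>Strict bounds spare the predecessors of k and j, so the inclusion-exclusion
    below also covers k = 0 and j = 0.\<close>
  define L where "L k j = card {xs \<in> nro_partitions N. cols xs < k \<and> length xs < j}" for k j
  have L: "L k j = L j k" for k j
  proof (cases k; cases j)
    fix k' j' assume "k = Suc k'" "j = Suc j'"
    then show ?thesis using card_box_commute[of N k' j'] by (simp add: L_def less_Suc_eq_le)
  qed (simp_all add: L_def)
  have split: "card {xs \<in> nro_partitions N. R xs} = card {xs \<in> nro_partitions N. P xs} + card {xs \<in> nro_partitions N. Q xs}"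
    if "\<And>xs. R xs \<longleftrightarrow> P xs \<or> Q xs" "\<And>xs. \<not> (P xs \<and> Q xs)" for P Q R
  proof -
    have "{xs \<in> nro_partitions N. R xs} = {xs \<in> nro_partitions N. P xs} \<union> {xs \<in> nro_partitions N. Q xs}"
      using that(1) by blast
    then show ?thesis
      using that(2) by (simp only:) (rule card_Un_disjoint, auto simp: finite_nro_partitions)
  qed
  have E: "int (card {xs \<in> nro_partitions N. cols xs = k \<and> length xs = j}) =
      int (L (Suc k) (Suc j)) - int (L k (Suc j)) - int (L (Suc k) j) + int (L k j)" for k j
  proof -
    have "L (Suc k) i = L k i + card {xs \<in> nro_partitions N. cols xs = k \<and> length xs < i}" for i
      unfolding L_def by (rule split) auto
    moreover have "card {xs \<in> nro_partitions N. cols xs = k \<and> length xs < Suc j} =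
        card {xs \<in> nro_partitions N. cols xs = k \<and> length xs < j}
        + card {xs \<in> nro_partitions N. cols xs = k \<and> length xs = j}"
      by (rule split) auto
    ultimately show ?thesis by simp
  qed
  have "int (card {xs \<in> nro_partitions N. cols xs = k \<and> length xs = j}) =
        int (card {xs \<in> nro_partitions N. cols xs = j \<and> length xs = k})"
    unfolding E using L[of "Suc k" "Suc j"] L[of k "Suc j"] L[of "Suc k" j] L[of k j] by simp
  then show ?thesis by simp
qed

lemma sum_cols_length_commute:
  fixes g :: "nat \<Rightarrow> nat \<Rightarrow> int"
  shows "(\<Sum>xs\<in>nro_partitions N. g (cols xs) (length xs)) = (\<Sum>xs\<in>nro_partitions N. g (length xs) (cols xs))"
proof -
  have *: "(\<Sum>xs\<in>nro_partitions N. h (cols xs) (length xs)) =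
      (\<Sum>(k, j)\<in>{..N} \<times> {..N}. int (card {xs \<in> nro_partitions N. cols xs = k \<and> length xs = j}) * h k j)"
    for h :: "nat \<Rightarrow> nat \<Rightarrow> int"
  proof -
    have "(\<Sum>xs\<in>nro_partitions N. h (cols xs) (length xs)) =
        (\<Sum>p\<in>{..N} \<times> {..N}. \<Sum>xs\<in>{xs \<in> nro_partitions N. (cols xs, length xs) = p}. h (cols xs) (length xs))"
      by (rule sum.group[symmetric]) (auto simp: finite_nro_partitions cols_le length_le)
    also have "\<dots> = (\<Sum>(k, j)\<in>{..N} \<times> {..N}. int (card {xs \<in> nro_partitions N. cols xs = k \<and> length xs = j}) * h k j)"
      by (rule sum.cong) auto
    finally show ?thesis .
  qed
  show ?thesis
    unfolding *[of g] *[of "\<lambda>k j. g j k"]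
    by (rule sum.reindex_bij_witness[where i = "\<lambda>(k, j). (j, k)" and j = "\<lambda>(k, j). (j, k)"])
       (auto simp: card_exact_commute)
qed

section \<open>The second moment of the rank\<close>

lemma sum_odd_numbers: "(\<Sum>m\<in>{1..M}. 2 * int m - 1) = (int M)\<^sup>2"
  by (induction M) (simp_all add: power2_eq_square algebra_simps)

text \<open>Since n (c - n) + c (n - c) = -(c - n)^2, the symmetry makes the left side half of minus
  the sum of (c - n)^2. By symmetry again this half is carried by c > n, where (c - n)^2 is the sum
  of 2m - 1 over m \<le> c - n.\<close>

lemma sum_length_rank:
  "(\<Sum>xs\<in>nro_partitions N. int (length xs) * (int (cols xs) - int (length xs))) =
   - (\<Sum>m\<in>{1..N}. (2 * int m - 1) * int (card {xs \<in> nro_partitions N. length xs + m \<le> cols xs}))"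
proof -
  define g where "g k j = (if j < k then (int k - int j)\<^sup>2 else 0)" for k j :: nat
  have 1: "(\<Sum>xs\<in>nro_partitions N. int (length xs) * (int (cols xs) - int (length xs))) =
      (\<Sum>xs\<in>nro_partitions N. int (cols xs) * (int (length xs) - int (cols xs)))"
    by (rule sum_cols_length_commute[of "\<lambda>k j. int j * (int k - int j)"])
  have 2: "(\<Sum>xs\<in>nro_partitions N. g (cols xs) (length xs)) = (\<Sum>xs\<in>nro_partitions N. g (length xs) (cols xs))"
    by (rule sum_cols_length_commute)
  have "int (length xs) * (int (cols xs) - int (length xs)) + int (cols xs) * (int (length xs) - int (cols xs)) =
      - (g (cols xs) (length xs) + g (length xs) (cols xs))" for xs :: "nat list"
    by (simp add: g_def power2_eq_square algebra_simps)
  then have "(\<Sum>xs\<in>nro_partitions N. int (length xs) * (int (cols xs) - int (length xs))) +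
      (\<Sum>xs\<in>nro_partitions N. int (cols xs) * (int (length xs) - int (cols xs))) =
      - ((\<Sum>xs\<in>nro_partitions N. g (cols xs) (length xs)) + (\<Sum>xs\<in>nro_partitions N. g (length xs) (cols xs)))"
    by (simp only: sum.distrib[symmetric] sum_negf)
  with 1 2 have 3: "(\<Sum>xs\<in>nro_partitions N. int (length xs) * (int (cols xs) - int (length xs))) =
      - (\<Sum>xs\<in>nro_partitions N. g (cols xs) (length xs))" by linarith
  have "(\<Sum>xs\<in>nro_partitions N. g (cols xs) (length xs)) =
      (\<Sum>xs\<in>nro_partitions N. \<Sum>m\<in>{1..N}. if length xs + m \<le> cols xs then 2 * int m - 1 else 0)"
  proof (rule sum.cong[OF refl])
    fix xs assume "xs \<in> nro_partitions N"
    then have le: "cols xs \<le> N" by (rule cols_le)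
    have "(\<Sum>m\<in>{1..N}. if length xs + m \<le> cols xs then 2 * int m - 1 else 0) =
        (\<Sum>m\<in>{1..cols xs - length xs}. 2 * int m - 1)"
      by (rule sum.mono_neutral_cong_right) (use le in auto)
    then show "g (cols xs) (length xs) = (\<Sum>m\<in>{1..N}. if length xs + m \<le> cols xs then 2 * int m - 1 else 0)"
      unfolding sum_odd_numbers by (simp add: g_def of_nat_diff)
  qed
  also have "\<dots> = (\<Sum>m\<in>{1..N}. \<Sum>xs\<in>nro_partitions N. if length xs + m \<le> cols xs then 2 * int m - 1 else 0)"
    by (rule sum.swap)
  also have "\<dots> = (\<Sum>m\<in>{1..N}. (2 * int m - 1) * int (card {xs \<in> nro_partitions N. length xs + m \<le> cols xs}))"
  proof (rule sum.cong[OF refl])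
    fix m
    have "(\<Sum>xs\<in>nro_partitions N. if length xs + m \<le> cols xs then 2 * int m - 1 else 0) =
        (\<Sum>xs\<in>{xs \<in> nro_partitions N. length xs + m \<le> cols xs}. 2 * int m - 1)"
      by (rule sum.mono_neutral_cong_right) (auto simp: finite_nro_partitions)
    then show "(\<Sum>xs\<in>nro_partitions N. if length xs + m \<le> cols xs then 2 * int m - 1 else 0) =
        (2 * int m - 1) * int (card {xs \<in> nro_partitions N. length xs + m \<le> cols xs})"
      by (simp add: mult.commute)
  qed
  finally show ?thesis unfolding 3 by simp
qed

subsection \<open>The generating function of the rank\<close>

definition allgf :: "'a::comm_ring_1 fps" where "allgf = pgf (\<lambda>_. True)"
definition rankgf :: "nat \<Rightarrow> 'a::comm_ring_1 fps" where
  "rankgf m = pgf (\<lambda>xs. length xs + m \<le> cols xs)"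

lemma pgf_cols_eq:
  "pgf (\<lambda>xs. cols xs = Suc k \<and> length xs \<le> Suc j) =
     fps_X ^ (2 * k + 2) * boxgf (Suc k) j - fps_X ^ (2 * k + 1) * (boxgf k j :: 'a::comm_ring_1 fps)"
proof -
  have "(boxgf (Suc k) (Suc j) :: 'a fps) = boxgf k (Suc j) + pgf (\<lambda>xs. cols xs = Suc k \<and> length xs \<le> Suc j)"
    unfolding boxgf_def by (rule pgf_disjoint) auto
  then show ?thesis using boxgf_rec1[of k j, where ?'a = 'a] by (simp add: algebra_simps)
qed

lemma pgf_length_eq:
  "pgf (\<lambda>xs. length xs = Suc j \<and> cols xs \<le> Suc k) =
     fps_X ^ (2 * j + 2) * boxgf k (Suc j) - fps_X ^ (2 * j + 1) * (boxgf k j :: 'a::comm_ring_1 fps)"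
proof -
  have "(boxgf (Suc k) (Suc j) :: 'a fps) = boxgf (Suc k) j + pgf (\<lambda>xs. length xs = Suc j \<and> cols xs \<le> Suc k)"
    unfolding boxgf_def by (rule pgf_disjoint) auto
  then show ?thesis using boxgf_rec2[of k j, where ?'a = 'a] by (simp add: algebra_simps)
qed

text \<open>Sorted by columns: for cols = n + m + 1 the condition bounds the length by n + 1, which
  \<open>pgf_cols_eq\<close> evaluates. No index n \<ge> L matters, since a partition of N has at
  most N columns.\<close>

lemma rankgf_nth:
  assumes "N \<le> L"
  shows "fps_nth (rankgf m :: 'a::comm_ring_1 fps) N = fps_nth ((if m = 0 then 1 else 0) +
     (\<Sum>n<L. fps_X ^ (2 * (n + m) + 2) * boxgf (Suc (n + m)) n - fps_X ^ (2 * (n + m) + 1) * boxgf (n + m) n)) N"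
proof -
  have "fps_nth (rankgf m :: 'a fps) N =
      (\<Sum>n<Suc L. fps_nth (pgf (\<lambda>xs. length xs + m \<le> cols xs \<and> cols xs - m = n)) N)"
    unfolding rankgf_def by (rule pgf_nth_sum) (use assms in \<open>auto dest!: cols_le\<close>)
  also have "\<dots> = fps_nth (pgf (\<lambda>xs. length xs + m \<le> cols xs \<and> cols xs - m = 0)) N +
      (\<Sum>n<L. fps_nth (pgf (\<lambda>xs. length xs + m \<le> cols xs \<and> cols xs - m = Suc n)) N)"
    by (rule sum.lessThan_Suc_shift)
  \<comment> \<open>Here the length is 0 and there are exactly m columns, so only the empty
    partition can occur, and only for m = 0.\<close>
  also have "pgf (\<lambda>xs. length xs + m \<le> cols xs \<and> cols xs - m = 0) = (if m = 0 then 1 else (0 :: 'a fps))"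
  proof (cases "m = 0")
    case True
    have "pgf (\<lambda>xs. length xs + m \<le> cols xs \<and> cols xs - m = 0) = (pgf (\<lambda>xs. xs = []) :: 'a fps)"
      by (rule pgf_cong) (use True in \<open>auto simp: cols_eq_0_iff\<close>)
    then show ?thesis using True by (simp add: pgf_Nil)
  next
    case False
    have "pgf (\<lambda>xs. length xs + m \<le> cols xs \<and> cols xs - m = 0) = (pgf (\<lambda>xs. False) :: 'a fps)"
    proof (rule pgf_cong)
      fix N xs assume xs: "xs \<in> nro_partitions N"
      show "(length xs + m \<le> cols xs \<and> cols xs - m = 0) = False"
        using False cols_eq_0_iff[OF xs] by (cases xs) auto
    qed
    then show ?thesis using False by (simp add: pgf_def fps_eq_iff)
  qed
  also have "(\<lambda>n. pgf (\<lambda>xs. length xs + m \<le> cols xs \<and> cols xs - m = Suc n)) =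
      (\<lambda>n. fps_X ^ (2 * (n + m) + 2) * boxgf (Suc (n + m)) n - fps_X ^ (2 * (n + m) + 1) * (boxgf (n + m) n :: 'a fps))"
  proof
    fix n
    have "pgf (\<lambda>xs. length xs + m \<le> cols xs \<and> cols xs - m = Suc n) =
        (pgf (\<lambda>xs. cols xs = Suc (n + m) \<and> length xs \<le> Suc n) :: 'a fps)"
      by (rule pgf_cong) auto
    then show "pgf (\<lambda>xs. length xs + m \<le> cols xs \<and> cols xs - m = Suc n) =
       fps_X ^ (2 * (n + m) + 2) * boxgf (Suc (n + m)) n - fps_X ^ (2 * (n + m) + 1) * (boxgf (n + m) n :: 'a fps)"
      unfolding pgf_cols_eq .
  qed
  finally show ?thesis
    by (simp add: fps_sum_nth fun_eq_iff)
qed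

text \<open>The opposite condition is sorted by rows: for length n + 1 it bounds the columns by n +
  m + 2, as needed for \<open>pgf_length_eq\<close>.\<close>

lemma complement_rankgf_nth:
  assumes "N \<le> L"
  shows "fps_nth (allgf - rankgf (m + 2) :: 'a::comm_ring_1 fps) N = fps_nth (1 +
     (\<Sum>n<L. fps_X ^ (2 * n + 2) * boxgf (Suc (n + m)) (Suc n) - fps_X ^ (2 * n + 1) * boxgf (Suc (n + m)) n)) N"
proof -
  let ?P = "\<lambda>xs. cols xs \<le> length xs + m + 1"
  have "allgf = pgf ?P + (rankgf (m + 2) :: 'a fps)"
    unfolding allgf_def rankgf_def by (rule pgf_disjoint) auto
  then have "allgf - rankgf (m + 2) = (pgf ?P :: 'a fps)"
    by (simp add: diff_eq_eq)
  then have "fps_nth (allgf - rankgf (m + 2) :: 'a fps) N = fps_nth (pgf ?P) N" by (rule arg_cong)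
  also have "\<dots> = (\<Sum>n<Suc L. fps_nth (pgf (\<lambda>xs. ?P xs \<and> length xs = n)) N)"
    by (rule pgf_nth_sum) (use assms in \<open>auto dest!: length_le\<close>)
  also have "\<dots> = fps_nth (pgf (\<lambda>xs. ?P xs \<and> length xs = 0)) N + (\<Sum>n<L. fps_nth (pgf (\<lambda>xs. ?P xs \<and> length xs = Suc n)) N)"
    by (rule sum.lessThan_Suc_shift)
  also have "pgf (\<lambda>xs. ?P xs \<and> length xs = 0) = (1 :: 'a fps)"
    unfolding pgf_Nil[symmetric] by (rule pgf_cong) (auto simp: cols_def largest_part_def)
  also have "(\<lambda>n. pgf (\<lambda>xs. ?P xs \<and> length xs = Suc n)) =
      (\<lambda>n. fps_X ^ (2 * n + 2) * boxgf (Suc (n + m)) (Suc n) - fps_X ^ (2 * n + 1) * (boxgf (Suc (n + m)) n :: 'a fps))"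
  proof
    fix n
    have "pgf (\<lambda>xs. ?P xs \<and> length xs = Suc n) = (pgf (\<lambda>xs. length xs = Suc n \<and> cols xs \<le> Suc (Suc (n + m))) :: 'a fps)"
      by (rule pgf_cong) auto
    then show "pgf (\<lambda>xs. ?P xs \<and> length xs = Suc n) =
       fps_X ^ (2 * n + 2) * boxgf (Suc (n + m)) (Suc n) - fps_X ^ (2 * n + 1) * (boxgf (Suc (n + m)) n :: 'a fps)"
      unfolding pgf_length_eq .
  qed
  finally show ?thesis
    by (simp add: fps_sum_nth fun_eq_iff)
qed

text \<open>The expansion by columns for m and the one by rows for the complement at m + 2 involve
  the same boxes, (n + m) by n and (n + m + 1) by n. Their powers of q differ by the factor q^(2m +
  1) and their signs are opposite; the leading 1 of the complement is the box with n = 0.\<close>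

lemma rankgf_rec:
  "rankgf m = (if m = 0 then 1 else 0) - fps_X ^ (2 * m + 1) * (allgf - rankgf (m + 2) :: 'a::comm_ring_1 fps)"
proof (rule fps_ext)
  fix N
  let ?C = "1 + (\<Sum>n<N. fps_X ^ (2 * n + 2) * boxgf (Suc (n + m)) (Suc n)
      - fps_X ^ (2 * n + 1) * boxgf (Suc (n + m)) n) :: 'a fps"
  let ?B = "\<Sum>n<N. fps_X ^ (2 * (n + m) + 2) * boxgf (Suc (n + m)) n
      - fps_X ^ (2 * (n + m) + 1) * boxgf (n + m) n :: 'a fps"
  have "fps_nth (fps_X ^ (2 * m + 1) * (allgf - rankgf (m + 2) :: 'a fps)) N = fps_nth (fps_X ^ (2 * m + 1) * ?C) N"
    unfolding fps_X_power_mult_nth using complement_rankgf_nth[of "N - (2 * m + 1)" N m, where ?'a = 'a] by simp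
  also have "?C = (\<Sum>n<N. fps_X ^ (2 * n) * boxgf (n + m) n - fps_X ^ (2 * n + 1) * boxgf (Suc (n + m)) n)
      + fps_X ^ (2 * N) * boxgf (N + m) N"
  proof -
    have "1 + (\<Sum>n<N. fps_X ^ (2 * n + 2) * boxgf (Suc (n + m)) (Suc n)) =
        (\<Sum>n<Suc N. fps_X ^ (2 * n) * (boxgf (n + m) n :: 'a fps))"
      by (subst sum.lessThan_Suc_shift) (simp add: boxgf_0_right)
    then show ?thesis by (simp add: sum_subtractf add_diff_eq)
  qed
  also have "fps_X ^ (2 * m + 1) * \<dots> = - ?B + fps_X ^ (2 * m + 1 + 2 * N) * boxgf (N + m) N"
  proof -
    have "fps_X ^ (2 * m + 1) * (\<Sum>n<N. fps_X ^ (2 * n) * boxgf (n + m) n - fps_X ^ (2 * n + 1) * boxgf (Suc (n + m)) n) = - ?B"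
      unfolding sum_distrib_left sum_negf[symmetric]
    proof (rule sum.cong[OF refl])
      fix n
      have 1: "2 * (n + m) + 1 = (2 * m + 1) + 2 * n" and 2: "2 * (n + m) + 2 = (2 * m + 1) + (2 * n + 1)" by simp_all
      show "fps_X ^ (2 * m + 1) * (fps_X ^ (2 * n) * boxgf (n + m) n - fps_X ^ (2 * n + 1) * boxgf (Suc (n + m)) n) =
        - (fps_X ^ (2 * (n + m) + 2) * boxgf (Suc (n + m)) n - fps_X ^ (2 * (n + m) + 1) * (boxgf (n + m) n :: 'a fps))"
        unfolding 1 2 power_add[of fps_X "2 * m + 1"] by (simp only: right_diff_distrib mult.assoc minus_diff_eq)
    qed
    then show ?thesis by (simp only: distrib_left power_add mult.assoc)
  qed
  finally have "fps_nth (fps_X ^ (2 * m + 1) * (allgf - rankgf (m + 2) :: 'a fps)) N =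
      fps_nth (- ?B + fps_X ^ (2 * m + 1 + 2 * N) * boxgf (N + m) N) N" .
  \<comment> \<open>The one box left over by the index shift has a power of q beyond degree
    N.\<close>
  moreover have "fps_nth (fps_X ^ (2 * m + 1 + 2 * N) * boxgf (N + m) N :: 'a fps) N = 0"
    unfolding fps_X_power_mult_nth by simp
  ultimately have "fps_nth (fps_X ^ (2 * m + 1) * (allgf - rankgf (m + 2) :: 'a fps)) N = - fps_nth ?B N"
    by (simp only: fps_add_nth fps_neg_nth add_0_right)
  then show "fps_nth (rankgf m) N =
     fps_nth ((if m = 0 then 1 else 0) - fps_X ^ (2 * m + 1) * (allgf - rankgf (m + 2) :: 'a fps)) N"
    unfolding rankgf_nth[OF order_refl] by simp
qed

text \<open>By the symmetry there are as many partitions with c < n as with c > n.\<close>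

lemma rankgf_0_1: "rankgf 0 + rankgf 1 = (allgf :: 'a::comm_ring_1 fps)"
proof -
  have "pgf (\<lambda>xs. cols xs < length xs) = (rankgf 1 :: 'a fps)"
  proof (rule fps_ext)
    fix N
    have card_sum: "int (card {xs \<in> nro_partitions N. P xs}) = (\<Sum>xs\<in>nro_partitions N. if P xs then 1 else 0)" for P
      by (simp add: sum.If_cases finite_nro_partitions Int_def)
    have "int (card {xs \<in> nro_partitions N. cols xs < length xs}) =
        int (card {xs \<in> nro_partitions N. length xs + 1 \<le> cols xs})"
      unfolding card_sum
      using sum_cols_length_commute[of "\<lambda>k j. if k < j then 1 else 0" N] by (simp add: less_eq_Suc_le cong: if_cong)
    then show "fps_nth (pgf (\<lambda>xs. cols xs < length xs)) N = fps_nth (rankgf 1 :: 'a fps) N"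
      by (simp add: pgf_nth rankgf_def)
  qed
  moreover have "allgf = rankgf 0 + (pgf (\<lambda>xs. cols xs < length xs) :: 'a fps)"
    unfolding allgf_def rankgf_def by (rule pgf_disjoint) auto
  ultimately show ?thesis by simp
qed

section \<open>The series H_m and the theta series psi\<close>

definition hook_series :: "nat \<Rightarrow> 'a::comm_ring_1 fps" where
  "hook_series m = Lam (\<lambda>n d. if d + 1 = 2 * n + 2 * m then 1 else 0)"

lemma hook_series_nth:
  assumes "0 < m"
  shows "fps_nth (hook_series m) N = (if \<exists>n>0. N = n * (2 * n + 2 * m - 1) then 1 else 0)"
proof -
  have "(\<Sum>(n, d)\<in>facs N. if d + 1 = 2 * n + 2 * m then 1 else 0 :: 'a) =
      (\<Sum>p\<in>{(n, d) \<in> facs N. d + 1 = 2 * n + 2 * m}. 1)"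
    by (rule sum.mono_neutral_cong_right) (auto simp: finite_facs split: if_splits)
  also have "\<dots> = (if \<exists>n>0. N = n * (2 * n + 2 * m - 1) then 1 else 0)"
  proof (cases "\<exists>n>0. N = n * (2 * n + 2 * m - 1)")
    case True
    then obtain n where n: "0 < n" "N = n * (2 * n + 2 * m - 1)" by blast
    have "{(n, d) \<in> facs N. d + 1 = 2 * n + 2 * m} = {(n, 2 * n + 2 * m - 1)}"
    proof (rule set_eqI, clarify)
      fix n' d
      have "n' = n" if "0 < n'" "n' * (2 * n' + 2 * m - 1) = n * (2 * n + 2 * m - 1)"
      proof (rule ccontr)
        assume "n' \<noteq> n"
        then consider "n' < n" | "n < n'" by linarith
        then show False
        proof cases
          case 1
          then have "n' * (2 * n' + 2 * m - 1) < n * (2 * n + 2 * m - 1)"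
            using that(1) assms by (intro mult_strict_mono) auto
          with that(2) show False by simp
        next
          case 2
          then have "n * (2 * n + 2 * m - 1) < n' * (2 * n' + 2 * m - 1)"
            using n(1) assms by (intro mult_strict_mono) auto
          with that(2) show False by simp
        qed
      qed
      note uniq = this
      have d: "d + 1 = 2 * n' + 2 * m \<longleftrightarrow> d = 2 * n' + 2 * m - 1" using assms by linarith
      have "0 < 2 * n + 2 * m - 1" using assms by linarith
      then show "(n', d) \<in> {(n, d) \<in> facs N. d + 1 = 2 * n + 2 * m} \<longleftrightarrow> (n', d) \<in> {(n, 2 * n + 2 * m - 1)}"
        using n uniq unfolding mem_Collect_eq prod.case facs_def d by blast
    qed
    then show ?thesis using True by simp
  next
    case False
    have "{(n, d) \<in> facs N. d + 1 = 2 * n + 2 * m} = {}"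
    proof (rule ccontr)
      assume "{(n, d) \<in> facs N. d + 1 = 2 * n + 2 * m} \<noteq> {}"
      then obtain n d where nd: "0 < n" "n * d = N" "d + 1 = 2 * n + 2 * m" by (auto simp: facs_def)
      then have "d = 2 * n + 2 * m - 1" by linarith
      with nd False show False by blast
    qed
    then show ?thesis using False by (simp only: sum.empty if_False)
  qed
  finally show ?thesis unfolding hook_series_def Lam_nth .
qed

text \<open>For n = k + 1 the exponent is 2m + 1 + k (2k + 2m + 3), whose last summand is the
  exponent of index k for m + 2; k = 0 accounts for the 1.\<close>

lemma hook_series_rec:
  assumes "0 < m"
  shows "hook_series m = fps_X ^ (2 * m + 1) * (1 + hook_series (m + 2))"
proof (rule fps_ext)
  fix N
  let ?f = "\<lambda>n. n * (2 * n + 2 * m - 1)" and ?g = "\<lambda>n. n * (2 * n + 2 * (m + 2) - 1)"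
  have fg: "?f (Suc k) = 2 * m + 1 + ?g k" for k
    using assms by (cases m) (simp_all add: algebra_simps)
  have iff: "(\<exists>n>0. N = ?f n) \<longleftrightarrow> 2 * m + 1 \<le> N \<and> (N - (2 * m + 1) = 0 \<or> (\<exists>n>0. N - (2 * m + 1) = ?g n))"
    (is "?l \<longleftrightarrow> ?r")
  proof
    assume ?l
    then obtain n where "0 < n" "N = ?f n" by blast
    then obtain k where k: "N = 2 * m + 1 + ?g k" using fg by (metis gr0_implies_Suc)
    then have "2 * m + 1 \<le> N" "N - (2 * m + 1) = ?g k" by linarith+
    then show ?r by (cases "k = 0") (simp, blast)
  next
    assume r: ?r
    then obtain k where "N - (2 * m + 1) = ?g k" by (metis mult_0)
    with r have "N = 2 * m + 1 + ?g k" by linarith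
    then have "N = ?f (Suc k)" unfolding fg .
    then show ?l by blast
  qed
  have pos: "0 < m + 2" by simp
  define Q where "Q \<longleftrightarrow> (\<exists>n>0. N - (2 * m + 1) = ?g n)"
  have "Q \<Longrightarrow> N - (2 * m + 1) \<noteq> 0" by (auto simp: Q_def)
  then show "fps_nth (hook_series m) N = fps_nth (fps_X ^ (2 * m + 1) * (1 + hook_series (m + 2))) N"
    unfolding hook_series_nth[OF assms] iff fps_X_power_mult_nth fps_add_nth hook_series_nth[OF pos] fps_one_nth
      Q_def[symmetric]
    by auto
qed

text \<open>Iteration pushes the order of \<open>z m\<close> beyond every bound. This is the
  uniqueness statement for the recursion in m.\<close>

lemma eq_zero_of_shift:
  fixes z :: "nat \<Rightarrow> 'a::comm_ring_1 fps"
  assumes "\<And>m. 0 < m \<Longrightarrow> z m = fps_X ^ (2 * m + 1) * z (m + 2)" "0 < m"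
  shows "z m = 0"
proof (rule fps_ext)
  fix N
  show "fps_nth (z m) N = fps_nth 0 N"
    using assms(2)
  proof (induction N arbitrary: m rule: less_induct)
    case (less N)
    have "fps_nth (z m) N = fps_nth (fps_X ^ (2 * m + 1) * z (m + 2)) N"
      using assms(1)[OF less.prems] by (rule arg_cong)
    also have "\<dots> = 0"
      unfolding fps_X_power_mult_nth using less.IH[of "N - (2 * m + 1)" "m + 2"] by simp
    finally show ?case by simp
  qed
qed

text \<open>For m > 0 both sides satisfy the recursion \<open>rankgf_rec\<close>, so their
  difference is subject to \<open>eq_zero_of_shift\<close>.\<close>

lemma rankgf_hook_series:
  assumes "0 < m"
  shows "rankgf m = - (allgf * hook_series m)"
proof -
  have "rankgf m + allgf * hook_series m = 0"
  proof (rule eq_zero_of_shift[where z = "\<lambda>m. rankgf m + allgf * hook_series m", OF _ assms])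
    fix m :: nat assume m: "0 < m"
    show "rankgf m + allgf * hook_series m = fps_X ^ (2 * m + 1) * (rankgf (m + 2) + allgf * hook_series (m + 2))"
      unfolding hook_series_rec[OF m] by (subst rankgf_rec) (use m in \<open>simp add: algebra_simps\<close>)
  qed
  then show ?thesis by (simp add: eq_neg_iff_add_eq_0)
qed

lemma tri_even: "tri (2 * n) = n * (2 * n + 1)" and tri_odd: "tri (2 * n + 1) = 1 + n * (2 * n + 3)"
  using two_tri[of "2 * n"] two_tri[of "2 * n + 1"] by (simp_all add: algebra_simps)

text \<open>Triangular numbers of even index 2n are n (2n + 1), the exponents of H_1; those of odd
  index are 1 + n (2n + 3), those of H_2 shifted by one. The two ones stand for n = 0.\<close>

lemma psi_hook_series: "psi = 1 + hook_series 1 + fps_X * (1 + hook_series 2)"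
proof (rule fps_ext)
  fix N
  have 1: "fps_nth (hook_series 1 :: 'a fps) N = (if \<exists>n>0. N = tri (2 * n) then 1 else 0)"
    by (subst hook_series_nth) (simp_all add: tri_even)
  have 2: "fps_nth (fps_X * (1 + hook_series 2) :: 'a fps) N = (if \<exists>n. N = tri (2 * n + 1) then 1 else 0)"
  proof (cases N)
    case 0
    then show ?thesis unfolding tri_odd by simp
  next
    case (Suc M)
    have "fps_nth (fps_X * (1 + hook_series 2) :: 'a fps) N =
        (if M = 0 then 1 else 0) + (if \<exists>n>0. M = n * (2 * n + 3) then 1 else 0)"
      unfolding Suc by (simp add: hook_series_nth add.commute)
    also have "\<dots> = (if \<exists>n. M = n * (2 * n + 3) then 1 else 0)"
      by (cases "M = 0") (auto, metis mult_0 neq0_conv)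
    finally show ?thesis unfolding Suc tri_odd by simp
  qed
  show "fps_nth psi N = fps_nth (1 + hook_series 1 + fps_X * (1 + hook_series 2) :: 'a fps) N"
  proof (cases "N \<in> range tri")
    case True
    then obtain i where i: "N = tri i" by blast
    have t0: "0 = tri 0" by (simp add: tri_def)
    have "N = 0 \<longleftrightarrow> i = 0" unfolding i by (subst t0) (rule tri_eq_iff)
    moreover have "(\<exists>n>0. N = tri (2 * n)) \<longleftrightarrow> even i \<and> i \<noteq> 0"
      unfolding i tri_eq_iff by (auto elim!: evenE)
    moreover have "(\<exists>n. N = tri (2 * n + 1)) \<longleftrightarrow> odd i"
      unfolding i tri_eq_iff by (auto elim!: oddE)
    ultimately show ?thesis
      using True by (simp only: fps_add_nth 1 2 psi_nth fps_one_nth) auto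
  next
    case False
    then have "N \<noteq> 0" by (metis rangeI tri_def mult_0 div_0)
    with False show ?thesis
      by (simp only: fps_add_nth 1 2 psi_nth fps_one_nth) auto
  qed
qed

text \<open>The recursion at m = 0 together with \<open>rankgf_0_1\<close> is a linear equation for
  P, in which H_1 and H_2 assemble to psi.\<close>

lemma allgf_psi: "allgf * psi = 1"
proof -
  have "allgf = rankgf 0 + rankgf 1" by (rule rankgf_0_1[symmetric])
  also have "rankgf 0 = 1 - fps_X * (allgf - rankgf 2)"
    using rankgf_rec[of 0] by (simp add: numeral_2_eq_2)
  finally have "allgf = 1 - fps_X * (allgf - rankgf 2) + rankgf 1" .
  then show ?thesis
    unfolding psi_hook_series by (simp add: rankgf_hook_series algebra_simps)
qed

subsection \<open>The logarithmic derivative and the congruence\<close>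

lemma qD_X_power: "qD (fps_X ^ n :: 'a::comm_ring_1 fps) = of_nat n * fps_X ^ n"
proof (rule fps_ext)
  fix i
  have "fps_nth (of_nat n * fps_X ^ n :: 'a fps) i = of_nat n * fps_nth (fps_X ^ n) i"
    by (metis fps_mult_left_const_nth fps_of_nat)
  then show "fps_nth (qD (fps_X ^ n)) i = fps_nth (of_nat n * fps_X ^ n :: 'a fps) i"
    by (simp add: qD_nth fps_X_power_nth)
qed

text \<open>The coefficient ring may have zero divisors, so cancellation is by order: a series equal
  to q^p times itself vanishes.\<close>

lemma cancel_one_minus_X_power:
  fixes f g :: "'a::comm_ring_1 fps"
  assumes "0 < p" "(1 - fps_X ^ p) * f = (1 - fps_X ^ p) * g"
  shows "f = g"
proof -
  define h where "h = f - g"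
  have h: "h = fps_X ^ p * h"
    using assms(2) by (simp add: h_def algebra_simps)
  have "fps_nth h n = 0" for n
  proof (induction n rule: less_induct)
    case (less n)
    have "fps_nth h n = fps_nth (fps_X ^ p * h) n" using h by (rule arg_cong)
    also have "\<dots> = 0"
      unfolding fps_X_power_mult_nth using less[of "n - p"] assms(1) by simp
    finally show ?case .
  qed
  then have "h = 0" by (simp add: fps_eq_iff)
  then show ?thesis by (simp add: h_def)
qed

text \<open>The expansion of d q^d / (1 - q^d), minus the logarithmic derivative of 1 - q^d.\<close>

definition divisor_series :: "nat \<Rightarrow> 'a::comm_ring_1 fps" where
  "divisor_series d = Lam (\<lambda>e k. if e = d then of_nat d else 0)"

lemma divisor_series_nth:
  assumes "0 < d"
  shows "fps_nth (divisor_series d) n = (if d dvd n \<and> 0 < n then of_nat d else 0)"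
proof -
  have "(\<Sum>(e, k)\<in>facs n. if e = d then of_nat d else 0 :: 'a) = (\<Sum>p\<in>{(e, k) \<in> facs n. e = d}. of_nat d)"
    by (rule sum.mono_neutral_cong_right) (auto simp: finite_facs split: if_splits)
  also have "{(e, k) \<in> facs n. e = d} = (if d dvd n \<and> 0 < n then {(d, n div d)} else {})"
    using assms by (auto simp: facs_def elim!: dvdE)
  finally show ?thesis
    unfolding divisor_series_def Lam_nth by simp
qed

lemma divisor_series_mult:
  assumes "0 < d"
  shows "(1 - fps_X ^ d) * divisor_series d = of_nat d * (fps_X ^ d :: 'a::comm_ring_1 fps)"
proof (rule fps_ext)
  fix n
  have *: "fps_nth (of_nat d * fps_X ^ d :: 'a fps) n = of_nat d * fps_nth (fps_X ^ d) n"
    by (metis fps_mult_left_const_nth fps_of_nat)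
  have "fps_nth ((1 - fps_X ^ d) * divisor_series d) n =
      fps_nth (divisor_series d) n - (if n < d then 0 else fps_nth (divisor_series d :: 'a fps) (n - d))"
    by (simp add: left_diff_distrib fps_X_power_mult_nth)
  also have "\<dots> = (if n = d then of_nat d else 0)"
    unfolding divisor_series_nth[OF assms] using assms
    by (cases "n < d") (auto simp: dvd_minus_self dest: dvd_imp_le)
  finally show "fps_nth ((1 - fps_X ^ d) * divisor_series d) n = fps_nth (of_nat d * fps_X ^ d :: 'a fps) n"
    unfolding * by (simp add: fps_X_power_nth)
qed

section \<open>Finite products and their logarithmic derivatives\<close>

definition partgf :: "nat \<Rightarrow> 'a::comm_ring_1 fps" where
  "partgf k = pgf (\<lambda>xs. cols xs \<le> k)"

definition alt_sig :: "nat \<Rightarrow> 'a::comm_ring_1 fps" where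
  "alt_sig k = Lam (\<lambda>d e. if d \<le> 2 * k then (- 1) ^ (d + 1) * of_nat d else 0)"

lemma partgf_nth: "N \<le> j \<Longrightarrow> fps_nth (partgf k) N = fps_nth (boxgf k j) N"
  unfolding partgf_def boxgf_def pgf_nth
  by (intro arg_cong2[of _ _ _ _ "(*)"] refl arg_cong[of _ _ of_nat] arg_cong[of _ _ card])
     (use length_le in \<open>fastforce\<close>)

lemma partgf_0: "partgf 0 = 1"
  unfolding partgf_def pgf_Nil[symmetric] by (rule pgf_cong) (auto simp: cols_eq_0_iff)

text \<open>The limit of \<open>boxgf_rec1\<close> for unbounded length. It makes
  \<open>partgf k\<close> the product of (1 - q^(2i + 1)) / (1 - q^(2i + 2)) over i < k.\<close>

lemma partgf_rec:
  "(1 - fps_X ^ (2 * k + 2)) * partgf (Suc k) = (1 - fps_X ^ (2 * k + 1)) * (partgf k :: 'a::comm_ring_1 fps)"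
proof -
  have "partgf (Suc k) = partgf k + fps_X ^ (2 * k + 2) * partgf (Suc k) - fps_X ^ (2 * k + 1) * (partgf k :: 'a fps)"
  proof (rule fps_ext)
    fix N
    have 1: "fps_nth (partgf i :: 'a fps) N = fps_nth (boxgf i (Suc N)) N" for i
      by (rule partgf_nth) simp
    have 2: "fps_nth (fps_X ^ p * partgf i :: 'a fps) N = fps_nth (fps_X ^ p * boxgf i N) N" for p i
      unfolding fps_X_power_mult_nth using partgf_nth[of "N - p" N i, where ?'a = 'a] by simp
    show "fps_nth (partgf (Suc k)) N =
        fps_nth (partgf k + fps_X ^ (2 * k + 2) * partgf (Suc k) - fps_X ^ (2 * k + 1) * (partgf k :: 'a fps)) N"
      unfolding fps_add_nth fps_sub_nth 2 unfolding 1 boxgf_rec1 fps_add_nth fps_sub_nth ..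
  qed
  then show ?thesis by (simp add: algebra_simps)
qed

lemma alt_sig_Suc: "alt_sig (Suc k) = alt_sig k + divisor_series (2 * k + 1) - divisor_series (2 * k + 2)"
  unfolding alt_sig_def divisor_series_def Lam_add Lam_diff
proof (rule Lam_cong)
  fix d e :: nat
  consider "d \<le> 2 * k" | "d = 2 * k + 1" | "d = 2 * k + 2" | "2 * k + 2 < d" by linarith
  then show "(if d \<le> 2 * Suc k then (- 1) ^ (d + 1) * of_nat d else 0) =
     (if d \<le> 2 * k then (- 1) ^ (d + 1) * of_nat d else 0) +
     (if d = 2 * k + 1 then of_nat (2 * k + 1) else 0) - (if d = 2 * k + 2 then of_nat (2 * k + 2) else (0::'a))"
    by cases simp_all
qed

text \<open>The logarithmic derivative of g' = g (1 - a) / (1 - b) with denominators cleared: -u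
  belongs to g, and da and db stand for D a / (1 - a) and D b / (1 - b).\<close>

lemma log_derivative_step:
  fixes g g' u a b da db :: "'a::comm_ring_1"
  assumes "(1 - b) * g' = (1 - a) * g" "(1 - a) * da = ea * a" "(1 - b) * db = eb * b"
    and "(1 - b) * dg' - eb * b * g' = (1 - a) * - (u * g) - ea * a * g"
  shows "(1 - b) * dg' = (1 - b) * - ((u + da - db) * g')"
proof -
  have "(1 - b) * - ((u + da - db) * g') = - (u + da) * ((1 - b) * g') + ((1 - b) * db) * g'"
    by (simp add: algebra_simps)
  also have "\<dots> = (1 - a) * - (u * g) - ((1 - a) * da) * g + ((1 - b) * db) * g'"
    unfolding assms(1) by (simp add: algebra_simps)
  also have "\<dots> = (1 - b) * dg'"
    unfolding assms(2,3) using assms(4) by (simp add: algebra_simps)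
  finally show ?thesis ..
qed

lemma qD_partgf: "qD (partgf k) = - (alt_sig k * partgf k :: 'a::comm_ring_1 fps)"
proof (induction k)
  case 0
  have "alt_sig 0 = (0 :: 'a fps)"
    by (rule fps_ext) (auto simp: alt_sig_def Lam_nth facs_def intro!: sum.neutral)
  then show ?case by (simp add: partgf_0 qD_1)
next
  case (Suc k)
  let ?a = "fps_X ^ (2 * k + 1) :: 'a fps" and ?b = "fps_X ^ (2 * k + 2) :: 'a fps"
  have "qD ((1 - ?b) * partgf (Suc k)) = qD ((1 - ?a) * partgf k)"
    unfolding partgf_rec ..
  then have d: "(1 - ?b) * qD (partgf (Suc k)) - of_nat (2 * k + 2) * ?b * partgf (Suc k) =
      (1 - ?a) * - (alt_sig k * partgf k) - of_nat (2 * k + 1) * ?a * partgf k"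
    unfolding qD_mult qD_diff qD_1 qD_X_power Suc by (simp add: algebra_simps)
  have "(1 - ?b) * qD (partgf (Suc k)) =
      (1 - ?b) * - ((alt_sig k + divisor_series (2 * k + 1) - divisor_series (2 * k + 2)) * partgf (Suc k))"
    by (rule log_derivative_step[OF partgf_rec divisor_series_mult divisor_series_mult d]) simp_all
  then show ?case
    unfolding alt_sig_Suc by (rule cancel_one_minus_X_power[rotated]) simp
qed

text \<open>Up to degree N the finite product \<open>partgf N\<close> agrees with P and
  \<open>alt_sig N\<close> with the full Lambert series, so no infinite product is formed.\<close>

lemma qD_allgf: "qD allgf = - (Lam (\<lambda>d e. (- 1) ^ (d + 1) * of_nat d) * allgf :: 'a::comm_ring_1 fps)"
proof (rule fps_ext)
  fix N
  have p: "fps_nth (partgf N :: 'a fps) i = fps_nth allgf i" if "i \<le> N" for i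
    unfolding partgf_def allgf_def pgf_nth
    by (intro arg_cong2[of _ _ _ _ "(*)"] refl arg_cong[of _ _ of_nat] arg_cong[of _ _ card])
       (use that cols_le in \<open>fastforce\<close>)
  have a: "fps_nth (alt_sig N :: 'a fps) i = fps_nth (Lam (\<lambda>d e. (- 1) ^ (d + 1) * of_nat d)) i" if "i \<le> N" for i
    unfolding alt_sig_def Lam_nth
  proof (rule sum.cong[OF refl], clarify)
    fix d e assume "(d, e) \<in> facs i"
    then have "d \<le> i" by (auto simp: facs_def)
    with that show "(if d \<le> 2 * N then (- 1) ^ (d + 1) * of_nat d else 0) = ((- 1) ^ (d + 1) * of_nat d :: 'a)" by simp
  qed
  have "fps_nth (qD allgf :: 'a fps) N = fps_nth (qD (partgf N)) N"
    unfolding qD_nth by (simp add: p)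
  also have "\<dots> = - fps_nth (alt_sig N * partgf N) N"
    unfolding qD_partgf by simp
  also have "fps_nth (alt_sig N * partgf N) N = fps_nth (Lam (\<lambda>d e. (- 1) ^ (d + 1) * of_nat d) * (allgf :: 'a fps)) N"
    unfolding fps_mult_nth by (rule sum.cong[OF refl]) (simp only: atLeastAtMost_iff p a diff_le_self)
  finally show "fps_nth (qD allgf) N = fps_nth (- (Lam (\<lambda>d e. (- 1) ^ (d + 1) * of_nat d) * allgf :: 'a fps)) N"
    by simp
qed

lemma alternating_sig: "Lam (\<lambda>d e. (- 1) ^ (d + 1) * of_nat d) = sig + sig2"
proof -
  have "Lam (\<lambda>d e. (- 1) ^ (d + 1) * of_nat d :: 5) = sig - 2 * (2 * sig2)"
    unfolding two_sig2 sig_def Lam_numeral_mult Lam_diff by (rule Lam_cong) (simp add: minus_one_power_iff)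
  also have "\<dots> = sig + sig2"
    by (rule eq_mod5[OF five_fps, where c = "- sig2"]) (simp add: algebra_simps)
  finally show ?thesis .
qed

lemma allgf_X1_derivative:
  "\<exists>V. allgf * X1 = qD (allgf * V) - allgf * V"
proof -
  define u where "u = sig + sig2"
  define F :: "5 fps" where "F = allgf"
  have psiF: "F * psi = 1" unfolding F_def by (rule allgf_psi)
  have dF: "qD F = - (u * F)"
    unfolding F_def qD_allgf alternating_sig u_def ..
  have dpsi: "qD psi = u * psi"
  proof -
    have "qD (F * psi) = 0" unfolding psiF qD_1 ..
    then have "- (u * (F * psi)) + F * qD psi = 0" unfolding qD_mult dF by (simp add: mult.assoc)
    then have "F * qD psi = u" unfolding psiF by (simp add: add_eq_0_iff)
    then have "psi * (F * qD psi) = psi * u" by (rule arg_cong)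
    then have "(F * psi) * qD psi = u * psi" by (simp only: mult.assoc mult.commute mult.left_commute)
    then show ?thesis unfolding psiF by simp
  qed
  have ddpsi: "qD (qD psi) = (qD u + u ^ 2) * psi"
  proof -
    have "qD (qD psi) = qD (u * psi)" by (rule arg_cong[OF dpsi])
    also have "\<dots> = qD u * psi + u * (u * psi)" by (simp only: qD_mult dpsi)
    finally show ?thesis by (simp add: algebra_simps power2_eq_square)
  qed
  \<comment> \<open>As D F = -u F, the target divided by F is X1 = D V - u V - V. The lattice
    identity divided by psi equates this expression for \<open>W0\<close>, plus X1, with twice the
    same expression for \<open>cub4\<close> and \<open>lift_form\<close>.\<close>
  define V where "V = - W0 + 2 * cub4 + 2 * lift_form"
  have "F * (psi * (qD W0 - W0) - qD psi * W0 + psi * X1) = F * (2 * (psi * (qD cub4 - cub4) - qD psi * cub4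
      + qD (qD psi) * (sig4 - 1) + qD psi - 2 * (psi * sig4) - (psi + qD psi) * qD sig4 - psi * qD (qD sig4)))"
    unfolding weighted_series_identity ..
  moreover have "F * (psi * (qD W0 - W0) - qD psi * W0 + psi * X1) = (F * psi) * (qD W0 - W0 - u * W0 + X1)"
    unfolding dpsi by (simp add: algebra_simps)
  moreover have "F * (2 * (psi * (qD cub4 - cub4) - qD psi * cub4
      + qD (qD psi) * (sig4 - 1) + qD psi - 2 * (psi * sig4) - (psi + qD psi) * qD sig4 - psi * qD (qD sig4))) =
      (F * psi) * (2 * (qD cub4 - cub4 - u * cub4 + ((qD u + u ^ 2) * (sig4 - 1) + u - 2 * sig4
        - (1 + u) * qD sig4 - qD (qD sig4))))"
    unfolding ddpsi unfolding dpsi by (simp add: algebra_simps)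
  ultimately have *: "qD W0 - W0 - u * W0 + X1 =
      2 * (qD cub4 - cub4 - u * cub4 + (qD lift_form - u * lift_form - lift_form))"
    unfolding psiF u_def lift_form_identity by simp
  have dV: "qD V = - qD W0 + 2 * qD cub4 + 2 * qD lift_form"
    unfolding V_def qD_add qD_minus qD_numeral_mult ..
  have X1: "X1 = qD V - u * V - V"
    using * unfolding dV unfolding V_def by (simp add: algebra_simps)
  have "allgf * X1 = qD (allgf * V) - allgf * V"
    unfolding F_def[symmetric] qD_mult dF X1 by (simp add: algebra_simps)
  then show ?thesis ..
qed

lemma allgf_X1_nth_eq_0: "fps_nth (allgf * X1) (5 * n + 1) = 0"
proof -
  obtain V where "allgf * X1 = qD (allgf * V) - allgf * V"
    using allgf_X1_derivative by blast
  then have "fps_nth (allgf * X1) (5 * n + 1) = fps_nth (qD (allgf * V) - allgf * V) (5 * n + 1)" by (rule arg_cong)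
  also have "\<dots> = (of_nat (5 * n + 1) - 1) * fps_nth (allgf * V) (5 * n + 1)"
    unfolding fps_sub_nth qD_nth left_diff_distrib mult_1_left ..
  also have "(of_nat (5 * n + 1) - 1 :: 5) = 5 * of_nat n" by (simp only: of_nat_add of_nat_mult of_nat_numeral of_nat_1 add_diff_cancel_right')
  finally show ?thesis unfolding five by simp
qed

text \<open>The exponent of H_m factors as n d with d = 2n + 2m - 1, and then 2m - 1 = d - 2n. For
  fixed n and d at most one m occurs, namely when d is odd and exceeds 2n.\<close>

lemma X1_nth_hook_series:
  assumes "i \<le> N"
  shows "(\<Sum>m\<in>{1..N}. (2 * of_nat m - 1) * fps_nth (hook_series m) i) = fps_nth X1 i"
proof -
  have "(\<Sum>m\<in>{1..N}. (2 * of_nat m - 1) * fps_nth (hook_series m) i) =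
      (\<Sum>m\<in>{1..N}. \<Sum>(n, d)\<in>facs i. if d + 1 = 2 * n + 2 * m then 2 * of_nat m - 1 else (0::5))"
    unfolding hook_series_def Lam_nth sum_distrib_left by (intro sum.cong refl) auto
  also have "\<dots> = (\<Sum>(n, d)\<in>facs i. \<Sum>m\<in>{1..N}. if d + 1 = 2 * n + 2 * m then 2 * of_nat m - 1 else 0)"
    by (subst sum.swap) (simp add: case_prod_unfold)
  also have "\<dots> = fps_nth X1 i"
    unfolding X1_def Lam_nth
  proof (rule sum.cong[OF refl], clarify)
    fix n d assume nd: "(n, d) \<in> facs i"
    show "(\<Sum>m\<in>{1..N}. if d + 1 = 2 * n + 2 * m then 2 * of_nat m - 1 else 0) =
        (if odd d \<and> 2 * n < d then of_nat (d - 2 * n) else (0::5))"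
    proof (cases "odd d \<and> 2 * n < d")
      case True
      then obtain h where h: "d = 2 * h + 1" by (auto elim: oddE)
      define m where "m = h + 1 - n"
      have m: "d + 1 = 2 * n + 2 * m" "d - 2 * n + 1 = 2 * m" "0 < m" using True h by (auto simp: m_def)
      \<comment> \<open>From d \<le> i \<le> N it follows that m \<le> N, so cutting the sum at N
        loses nothing.\<close>
      have "d \<le> i" using nd by (auto simp: facs_def)
      then have "m \<in> {1..N}" using m(1,3) assms by auto
      have "(\<Sum>m'\<in>{1..N}. if d + 1 = 2 * n + 2 * m' then 2 * of_nat m' - 1 else (0::5)) =
          (\<Sum>m'\<in>{1..N}. if m' = m then 2 * of_nat m' - 1 else 0)"
        using m(1) by (intro sum.cong refl) auto
      also have "\<dots> = 2 * of_nat m - 1" using \<open>m \<in> {1..N}\<close> by (simp add: sum.delta)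
      also have "\<dots> = of_nat (2 * m) - 1" by (simp only: of_nat_mult of_nat_numeral)
      also have "\<dots> = of_nat (d - 2 * n)" by (simp only: m(2)[symmetric] of_nat_add of_nat_1 add_diff_cancel_right')
      finally show ?thesis unfolding if_P[OF True] .
    next
      case False
      have "d + 1 \<noteq> 2 * n + 2 * m" if "m \<in> {1..N}" for m
      proof
        assume *: "d + 1 = 2 * n + 2 * m"
        then have "odd d" by presburger
        moreover have "2 * n < d" using * that by auto
        ultimately show False using False by blast
      qed
      then have "(\<Sum>m\<in>{1..N}. if d + 1 = 2 * n + 2 * m then 2 * of_nat m - 1 else (0::5)) = 0"
        by (intro sum.neutral) auto
      then show ?thesis unfolding if_not_P[OF False] .
    qed
  qed
  finally show ?thesis .
qed

lemma sum_length_rank_pgf: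
  "(- 1) ^ N * of_int (\<Sum>xs\<in>nro_partitions N. int (length xs) * (int (cols xs) - int (length xs))) =
   - (\<Sum>m\<in>{1..N}. (2 * of_nat m - 1) * fps_nth (rankgf m :: 'a::comm_ring_1 fps) N)"
  unfolding sum_length_rank rankgf_def pgf_nth
  by (simp add: sum_distrib_left mult.left_commute)

text \<open>The exchange is made coefficientwise with finitely many m, so infinite sums of series
  are avoided; \<open>X1_nth_hook_series\<close> then evaluates the inner sum for every i \<le>
  N.\<close>

lemma fps_nth_mult_sum:
  fixes f :: "'a::comm_ring_1 fps"
  shows "(\<Sum>m\<in>A. c m * fps_nth (f * g m) N) =
    (\<Sum>i=0..N. fps_nth f (N - i) * (\<Sum>m\<in>A. c m * fps_nth (g m) i))"
proof -
  have "(\<Sum>m\<in>A. c m * fps_nth (f * g m) N) =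
      (\<Sum>m\<in>A. \<Sum>i=0..N. fps_nth f (N - i) * (c m * fps_nth (g m) i))"
    unfolding mult.commute[of f] fps_mult_nth sum_distrib_left
    by (intro sum.cong refl) (simp add: ac_simps)
  also have "\<dots> = (\<Sum>i=0..N. \<Sum>m\<in>A. fps_nth f (N - i) * (c m * fps_nth (g m) i))"
    by (rule sum.swap)
  finally show ?thesis unfolding sum_distrib_left .
qed

lemma fps_nth_mult_rev:
  fixes f :: "'a::comm_ring_1 fps"
  shows "fps_nth (f * g) N = (\<Sum>i=0..N. fps_nth f (N - i) * fps_nth g i)"
  unfolding mult.commute[of f] fps_mult_nth by (intro sum.cong refl) (rule mult.commute)

lemma sum_length_rank_mod5:
  "(- 1) ^ N * of_int (\<Sum>xs\<in>nro_partitions N. int (length xs) * (int (cols xs) - int (length xs))) =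
   fps_nth (allgf * X1) N"
proof -
  have "- (\<Sum>m\<in>{1..N}. (2 * of_nat m - 1) * fps_nth (rankgf m :: 5 fps) N) =
      (\<Sum>m\<in>{1..N}. (2 * of_nat m - 1) * fps_nth (allgf * hook_series m :: 5 fps) N)"
    unfolding sum_negf[symmetric]
  proof (rule sum.cong[OF refl])
    fix m assume "m \<in> {1..N}"
    then have "0 < m" by simp
    show "- ((2 * of_nat m - 1) * fps_nth (rankgf m :: 5 fps) N) =
        (2 * of_nat m - 1) * fps_nth (allgf * hook_series m) N"
      unfolding rankgf_hook_series[OF \<open>0 < m\<close>] fps_neg_nth mult_minus_right minus_minus ..
  qed
  also have "\<dots> = (\<Sum>i=0..N. fps_nth allgf (N - i) * fps_nth X1 i)"
    unfolding fps_nth_mult_sum by (rule sum.cong[OF refl]) (simp only: X1_nth_hook_series atLeastAtMost_iff)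
  finally show ?thesis unfolding sum_length_rank_pgf fps_nth_mult_rev[of allgf X1] .
qed

lemma five_dvd_sum_length_rank:
  "5 dvd (\<Sum>xs\<in>nro_partitions (5 * n + 1). int (length xs) * (int (cols xs) - int (length xs)))" (is "5 dvd ?S")
proof -
  have "(- 1) ^ (5 * n + 1) * of_int ?S = (0 :: 5)"
    unfolding sum_length_rank_mod5 by (rule allgf_X1_nth_eq_0)
  then have "of_int ?S = (0 :: 5)"
    by (cases "even (5 * n + 1)") (simp_all only: minus_one_power_iff if_True if_False mult_1_left mult_minus_left neg_equal_0_iff_equal)
  then show ?thesis unfolding of_int_eq_0_iff_char_dvd bit1.CHAR_eq by simp
qed

section \<open>Return to \<open>NT2\<close>\<close>

lemma M2_rank_eq: "M2_rank xs = int (cols xs) - int (length xs)"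
proof -
  have "\<lceil>real m / 2\<rceil> = int ((m + 1) div 2)" for m :: nat
    by (cases "even m") (auto elim!: evenE oddE simp: ceiling_unique add_divide_distrib)
  then show ?thesis by (simp add: M2_rank_def cols_def)
qed

lemma NT2_eq:
  "int (NT2 b 5 N) = (\<Sum>xs\<in>nro_partitions N. int (length xs) * (if [M2_rank xs = b] (mod 5) then 1 else 0))"
proof -
  have "int (NT2 b 5 N) = (\<Sum>xs\<in>{xs \<in> nro_partitions N. [M2_rank xs = b] (mod 5)}. int (length xs))"
    by (simp add: NT2_def nro_partitions_def conj_assoc)
  also have "\<dots> = (\<Sum>xs\<in>nro_partitions N. int (length xs) * (if [M2_rank xs = b] (mod 5) then 1 else 0))"
    by (rule sum.mono_neutral_cong_left) (auto simp: finite_nro_partitions)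
  finally show ?thesis .
qed

definition residue_weight :: "int \<Rightarrow> int" where
  "residue_weight r = (if [r = 1] (mod 5) then 1 else 0) - (if [r = 4] (mod 5) then 1 else 0)
     + 2 * (if [r = 2] (mod 5) then 1 else 0) - 2 * (if [r = 3] (mod 5) then 1 else 0)"

lemma residue_weight_cong: "[residue_weight r = r] (mod 5)"
proof -
  have "r mod 5 \<in> {0..<5}" by simp
  then have "r mod 5 = 0 \<or> r mod 5 = 1 \<or> r mod 5 = 2 \<or> r mod 5 = 3 \<or> r mod 5 = 4" by auto
  then show ?thesis unfolding residue_weight_def by (elim disjE) (simp_all add: cong_def)
qed

lemma NT2_combination:
  "int (NT2 1 5 N) - int (NT2 4 5 N) + 2 * int (NT2 2 5 N) - 2 * int (NT2 3 5 N) =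
   (\<Sum>xs\<in>nro_partitions N. int (length xs) * residue_weight (M2_rank xs))"
proof -
  have "int l * residue_weight r = int l * (if [r = 1] (mod 5) then 1 else 0) - int l * (if [r = 4] (mod 5) then 1 else 0)
     + 2 * (int l * (if [r = 2] (mod 5) then 1 else 0)) - 2 * (int l * (if [r = 3] (mod 5) then 1 else 0))" for l r
    unfolding residue_weight_def by (simp only: right_diff_distrib distrib_left mult.left_commute[of 2])
  then show ?thesis
    unfolding NT2_eq by (simp only: sum.distrib sum_subtractf sum_distrib_left)
qed

theorem theorem1p3:
  fixes n :: nat
  shows "[int (NT2 1 5 (5 * n + 1)) - int (NT2 4 5 (5 * n + 1))
          + 2 * int (NT2 2 5 (5 * n + 1)) - 2 * int (NT2 3 5 (5 * n + 1)) = 0] (mod 5)"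
proof -
  have "[(\<Sum>xs\<in>nro_partitions (5 * n + 1). int (length xs) * residue_weight (M2_rank xs)) =
      (\<Sum>xs\<in>nro_partitions (5 * n + 1). int (length xs) * M2_rank xs)] (mod 5)"
    by (intro cong_sum cong_mult cong_refl residue_weight_cong)
  also have "[(\<Sum>xs\<in>nro_partitions (5 * n + 1). int (length xs) * M2_rank xs) = 0] (mod 5)"
    unfolding M2_rank_eq cong_0_iff by (rule five_dvd_sum_length_rank)
  finally show ?thesis unfolding NT2_combination .
qed

end
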